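(* Let $f:[0,1]\rightarrow \mathbb{R}$ be quasi-continuous (at every point of $[0,1]$). Then, uniformly in $f$ given as input: (i) the set $C_f$ of points of $[0,1]$ at which $f$ is continuous is definable using $\exists^{2}$, and $\exists^{2}$ computes (in the sense of Kleene's S1–S9) some $x\in C_f$; (ii) there is a sequence $(O_n)_{n\in\mathbb{N}}$ of RM-open sets, definable in $\exists^{2}$, such that $C_f=\bigcap_{n\in\mathbb{N}}O_n$; (iii) the oscillation function $\mathsf{osc}_f:[0,1]\rightarrow\mathbb{R}$ is computable in $\exists^{2}$; (iv) for any $p,q\in\mathbb{Q}\cap[0,1]$, the supremum $\sup_{x\in[p,q]}f(x)$ is computable in $\exists^{2}$.
   Context: Computability is Kleene's higher-order computability given by his schemes S1–S9 (objects of finite type: naturals are type 0, elements of Baire space $\mathbb{N}^{\mathbb{N}}$ type 1, maps $\mathbb{N}^{\mathbb{N}}\to\mathbb{N}$ type 2, etc.; real numbers and functions on reals are represented in the usual way by such objects). $\exists^{2}$ (Kleene's quantifier) is the functional $\varphi:\mathbb{N}^{\mathbb{N}}\to\{0,1\}$ with $\varphi(f)=0\leftrightarrow(\exists n)(f(n)=0)$ for all $f\in\mathbb{N}^{\mathbb{N}}$. A function $f:[0,1]\to\mathbb{R}$ is quasi-continuous at $x_0$ if for every $\varepsilon>0$ and every open neighbourhood $U$ of $x_0$ there is a non-empty open $G\subset U$ with $|f(x_0)-f(x)|<\varepsilon$ for all $x\in G$. A set is RM-open if it is given by an RM-code, i.e. a sequence of open balls with rational centres and radii (the set being their union). $B(x,r)$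 is the open ball of radius $r$ around $x$. The oscillation function is $\mathsf{osc}_f([a,b]):=\sup_{x\in[a,b]}f(x)-\inf_{x\in[a,b]}f(x)$ and $\mathsf{osc}_f(x):=\lim_{k\to\infty}\mathsf{osc}_f(B(x,2^{-k}))$. $C_f$ denotes the set of points where $f$ is continuous.
   Formalization: Since a quasi-continuous f may be unbounded, osc_f and the supremum are taken in the extended reals; ∃² computes whether the value is finite and, if so, a name of the real; in (iv) p ≤ q is assumed so that [p,q] is non-empty. *)

theory Defs
  imports "HOL-Analysis.Analysis" "HOL-Library.Nat_Bijection" "HOL-Library.Countable"
begin

section \<open>Kleene computability S1--S9\<close>

text \<open>
  \<open>kleene e xs fs Fs y\<close> is Kleene's relation \<open>{e}(xs, fs, Fs) \<simeq> y\<close>, where the arguments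
  of type 0, 1 and 2 are listed separately (the relative order of arguments of different types is
  immaterial in Kleene's definition). An index is a coded sequence starting with the number of the
  scheme and the signature of its arguments. The only scheme that adds arguments of a new type is
  S8, which at type \<open>j\<close> adds an argument of type \<open>j - 2\<close>; hence computations whose
  arguments have type at most 2 only have subcomputations of the same kind, and the relation below
  is the exact restriction of Kleene's relation to such arguments.
\<close>

definition sig :: "nat list \<Rightarrow> (nat \<Rightarrow> nat) list \<Rightarrow> ((nat \<Rightarrow> nat) \<Rightarrow> nat) list \<Rightarrow> nat" where
  "sig xs fs Fs = list_encode [length xs, length fs, length Fs]"

definition to_front :: "nat \<Rightarrow> 'a list \<Rightarrow> 'a list" where
  "to_front k xs = xs ! k # take k xs @ drop (Suc k) xs"

inductive kleene ::
  "nat \<Rightarrow> nat list \<Rightarrow> (nat \<Rightarrow> nat) list \<Rightarrow> ((nat \<Rightarrow> nat) \<Rightarrow> nat) list \<Rightarrow> nat \<Rightarrow> bool"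
where
  S1: "kleene (list_encode [1, sig (x # xs) fs Fs]) (x # xs) fs Fs (Suc x)"
| S2: "kleene (list_encode [2, sig xs fs Fs, q]) xs fs Fs q"
| S3: "kleene (list_encode [3, sig (x # xs) fs Fs]) (x # xs) fs Fs x"
| S4: "kleene h xs fs Fs y \<Longrightarrow> kleene g (y # xs) fs Fs z \<Longrightarrow>
    kleene (list_encode [4, sig xs fs Fs, g, h]) xs fs Fs z"
| S5_0: "kleene g xs fs Fs y \<Longrightarrow>
    kleene (list_encode [5, sig (0 # xs) fs Fs, g, h]) (0 # xs) fs Fs y"
| S5_Suc: "kleene (list_encode [5, sig (x # xs) fs Fs, g, h]) (x # xs) fs Fs y \<Longrightarrow>
    kleene h (x # y # xs) fs Fs z \<Longrightarrow>
    kleene (list_encode [5, sig (Suc x # xs) fs Fs, g, h]) (Suc x # xs) fs Fs z"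
| S6_0: "k < length xs \<Longrightarrow> kleene g (to_front k xs) fs Fs y \<Longrightarrow>
    kleene (list_encode [6, sig xs fs Fs, 0, k, g]) xs fs Fs y"
| S6_1: "k < length fs \<Longrightarrow> kleene g xs (to_front k fs) Fs y \<Longrightarrow>
    kleene (list_encode [6, sig xs fs Fs, 1, k, g]) xs fs Fs y"
| S6_2: "k < length Fs \<Longrightarrow> kleene g xs fs (to_front k Fs) y \<Longrightarrow>
    kleene (list_encode [6, sig xs fs Fs, 2, k, g]) xs fs Fs y"
| S7: "kleene (list_encode [7, sig (x # xs) (f # fs) Fs]) (x # xs) (f # fs) Fs (f x)"
| S8: "(\<And>n. kleene h (n # xs) fs (F # Fs) (\<beta> n)) \<Longrightarrow>
    kleene (list_encode [8, sig xs fs (F # Fs), 2, h]) xs fs (F # Fs) (F \<beta>)"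
| S9: "kleene x xs fs Fs y \<Longrightarrow>
    kleene (list_encode [9, sig (x # xs @ xs') (fs @ fs') (Fs @ Fs'), sig xs fs Fs])
      (x # xs @ xs') (fs @ fs') (Fs @ Fs') y"

definition kleene_fun ::
  "nat \<Rightarrow> nat list \<Rightarrow> (nat \<Rightarrow> nat) list \<Rightarrow> ((nat \<Rightarrow> nat) \<Rightarrow> nat) list \<Rightarrow> (nat \<Rightarrow> nat) \<Rightarrow> bool"
where
  "kleene_fun e xs fs Fs \<gamma> \<longleftrightarrow> (\<forall>n. kleene e (n # xs) fs Fs (\<gamma> n))"

definition exists2 :: "(nat \<Rightarrow> nat) \<Rightarrow> nat" where
  "exists2 f = (if \<exists>n. f n = 0 then 0 else 1)"


section \<open>Representations\<close>

abbreviation q_of :: "nat \<Rightarrow> real" where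
  "q_of n \<equiv> of_rat (nat_to_rat_surj n)"

definition names_real :: "(nat \<Rightarrow> nat) \<Rightarrow> real \<Rightarrow> bool" where
  "names_real \<alpha> x \<longleftrightarrow>
    (\<forall>n i. \<bar>q_of (\<alpha> n) - q_of (\<alpha> (n + i))\<bar> < 1 / 2 ^ n) \<and> (\<lambda>n. q_of (\<alpha> n)) \<longlonglongrightarrow> x"

definition names_ereal :: "(nat \<Rightarrow> nat) \<Rightarrow> ereal \<Rightarrow> bool" where
  "names_ereal \<alpha> y \<longleftrightarrow>
    (case y of
      ereal x \<Rightarrow> \<alpha> 0 = 0 \<and> names_real (\<lambda>n. \<alpha> (Suc n)) x
    | PInfty \<Rightarrow> \<alpha> 0 = 1
    | MInfty \<Rightarrow> \<alpha> 0 = 2)"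

text \<open>
  A map \<open>[0,1] \<rightarrow> \<real>\<close> is given by a map \<open>\<Phi>\<close> from Baire space to itself that sends
  every name of \<open>x\<close> to a name of \<open>f x\<close>; \<open>\<Phi>\<close> is presented as the type 2 object \<open>F\<close>
  with \<open>F (n, \<alpha> 0, \<alpha> 1, \<dots>) = \<Phi> \<alpha> n\<close>.
\<close>

definition names_fun :: "((nat \<Rightarrow> nat) \<Rightarrow> nat) \<Rightarrow> (real \<Rightarrow> real) \<Rightarrow> bool" where
  "names_fun F f \<longleftrightarrow>
    (\<forall>x\<in>{0..1}. \<forall>\<alpha>. names_real \<alpha> x \<longrightarrow> names_real (\<lambda>n. F (case_nat n \<alpha>)) (f x))"

text \<open>The ball \<open>ball c r\<close> is empty for \<open>r \<le> 0\<close>, so the empty set has a code as well.\<close>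

definition RM_open_set :: "(nat \<Rightarrow> nat) \<Rightarrow> real set" where
  "RM_open_set c = (\<Union>m. case prod_decode (c m) of (a, r) \<Rightarrow> ball (q_of a) (q_of r))"


section \<open>Functions on the unit interval\<close>

definition quasi_continuous_at :: "(real \<Rightarrow> real) \<Rightarrow> real \<Rightarrow> bool" where
  "quasi_continuous_at f x0 \<longleftrightarrow>
    (\<forall>\<epsilon>>0. \<forall>U. openin (top_of_set {0..1}) U \<and> x0 \<in> U \<longrightarrow>
      (\<exists>G. openin (top_of_set {0..1}) G \<and> G \<noteq> {} \<and> G \<subseteq> U \<and> (\<forall>x\<in>G. \<bar>f x0 - f x\<bar> < \<epsilon>)))"

definition quasi_continuous :: "(real \<Rightarrow> real) \<Rightarrow> bool" where
  "quasi_continuous f \<longleftrightarrow> (\<forall>x\<in>{0..1}. quasi_continuous_at f x)"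

definition cont_points :: "(real \<Rightarrow> real) \<Rightarrow> real set" where
  "cont_points f = {x\<in>{0..1}. continuous (at x within {0..1}) f}"

text \<open>
  A quasi-continuous function may be unbounded, even near a single point, such as
  \<open>(sin (1 / x))\<^sup>2 / x\<close> with value 0 at 0. Suprema and oscillations are therefore taken in
  the extended reals.
\<close>

definition osc_on :: "(real \<Rightarrow> real) \<Rightarrow> real set \<Rightarrow> ereal" where
  "osc_on f S = (SUP x\<in>S. ereal (f x)) - (INF x\<in>S. ereal (f x))"

definition osc :: "(real \<Rightarrow> real) \<Rightarrow> real \<Rightarrow> ereal" where
  "osc f x = lim (\<lambda>k. osc_on f (ball x (1 / 2 ^ k) \<inter> {0..1}))"

end

theory Submission
  imports Defs
begin

text \<open>
  A quasi-continuous \<open>f\<close> takes, in every relatively open subset of \<open>[0,1]\<close>, values arbitrarily close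
  to any of its values there at rational points. Hence suprema over rational intervals and
  oscillations over open sets are suprema over rationals, and comparing them with rationals is
  arithmetical in the values of \<open>f\<close> at rationals, so \<open>\<exists>\<^sup>2\<close> decides it. An extended real whose left
  cut is decidable has a computable name, by unbounded search. The point \<open>x\<close> is a continuity point iff
  the oscillation at \<open>x\<close> is not positive, and \<open>C\<^sub>f\<close> is the intersection over \<open>n\<close> of the unions of the
  rational balls on which \<open>f\<close> varies by at most \<open>2\<^sup>-\<^sup>n\<close>. By quasi-continuity every ball contains a
  smaller ball of this kind, so always searching for the first suitable code yields nested balls
  that shrink to a continuity point.
\<close>

section \<open>Functions computable from the second-order quantifier\<close>

text \<open>The index must be found before \<open>f\<close> and its presentation \<open>F\<close>
  are given, so \<open>kcomp\<close> demands a value for every \<open>F\<close>, also for one that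
  names no function. Hence the tests \<open>exceeds\<close>, \<open>tame_code\<close>,
  \<open>below_osc\<close> and \<open>below_sup\<close> mention \<open>F\<close> but not
  \<open>f\<close> and are decidable for every \<open>F\<close>; only their agreement with
  \<open>f\<close> needs \<open>names_fun F f\<close> and quasi-continuity. Searches must be total
  for the same reason: \<open>exists2\<close> first decides whether a witness exists, and a default
  is returned if none does. \<open>F\<close> may give different names of \<open>f x\<close> for
  different names of \<open>x\<close>. It is evaluated only at constant names of rationals, and its
  output enters only through comparisons with error bounds. A real input only serves to test which
  rationals are near it. On the syntactic side, an index fixes the signature of its arguments and
  the schemes act on the front of the argument lists, so weakening and substitution must be derived
  from them. Once they are closure rules for \<open>kcomp\<close> and \<open>dec\<close>,
  computability claims follow by introduction rules along the structure of the formula.\<close>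

text \<open>
  The numerical arguments are presented as an environment \<open>\<rho>\<close> of which only the first \<open>a\<close>
  values are passed on; binding a variable shifts \<open>\<rho>\<close>. The relational version \<open>kpcomp\<close>, which
  only asks that the values allowed by \<open>R\<close> are computed, is needed for unbounded search.
\<close>

definition kpcomp :: "nat \<Rightarrow> nat \<Rightarrow>
    ((nat \<Rightarrow> nat) \<Rightarrow> (nat \<Rightarrow> nat) list \<Rightarrow> ((nat \<Rightarrow> nat) \<Rightarrow> nat) \<Rightarrow> nat \<Rightarrow> bool) \<Rightarrow> bool" where
  "kpcomp a b R \<longleftrightarrow> (\<exists>e. \<forall>\<rho> fs F y. length fs = b \<longrightarrow> R \<rho> fs F y \<longrightarrow>
     kleene e (map \<rho> [0..<a]) fs [F, exists2] y)"

definition kcomp :: "nat \<Rightarrow> nat \<Rightarrow>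
    ((nat \<Rightarrow> nat) \<Rightarrow> (nat \<Rightarrow> nat) list \<Rightarrow> ((nat \<Rightarrow> nat) \<Rightarrow> nat) \<Rightarrow> nat) \<Rightarrow> bool" where
  "kcomp a b \<phi> \<longleftrightarrow> kpcomp a b (\<lambda>\<rho> fs F y. y = \<phi> \<rho> fs F)"

lemma kcomp_iff: "kcomp a b \<phi> \<longleftrightarrow> (\<exists>e. \<forall>\<rho> fs F. length fs = b \<longrightarrow>
     kleene e (map \<rho> [0..<a]) fs [F, exists2] (\<phi> \<rho> fs F))"
  by (simp add: kcomp_def kpcomp_def)

lemma sig_simp: "sig xs fs [F, G] = list_encode [length xs, length fs, 2]"
  by (simp add: sig_def)

lemma Cons_map_upt: "y # map \<rho> [0..<a] = map (case_nat y \<rho>) [0..<Suc a]"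
  by (simp add: map_upt_Suc del: upt_Suc)

lemma kcomp_const: "kcomp a b (\<lambda>\<rho> fs F. c)"
proof -
  have "kleene (list_encode [2, list_encode [a, b, 2], c]) (map \<rho> [0..<a]) fs [F, exists2] c"
    if "length fs = b" for \<rho> fs F
    using S2[of "map \<rho> [0..<a]" fs "[F, exists2]" c] that by (simp add: sig_simp)
  then show ?thesis unfolding kcomp_iff by blast
qed

text \<open>S4 prepends the computed value to the arguments, which shifts the environment by one.
  The second computation may be partial, hence a relation \<open>R\<close>.\<close>

lemma kpcomp_let:
  assumes "kcomp a b h" "kpcomp (Suc a) b R"
  shows "kpcomp a b (\<lambda>\<rho> fs F y. R (case_nat (h \<rho> fs F) \<rho>) fs F y)"
proof -
  obtain eh where eh: "kleene eh (map \<rho> [0..<a]) fs [F, exists2] (h \<rho> fs F)"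
    if "length fs = b" for \<rho> fs F using assms(1) unfolding kcomp_iff by blast
  obtain eg where eg: "kleene eg (map \<rho> [0..<Suc a]) fs [F, exists2] y"
    if "length fs = b" "R \<rho> fs F y" for \<rho> fs F y using assms(2) unfolding kpcomp_def by blast
  have "kleene (list_encode [4, list_encode [a, b, 2], eg, eh]) (map \<rho> [0..<a]) fs [F, exists2] y"
    if "length fs = b" "R (case_nat (h \<rho> fs F) \<rho>) fs F y" for \<rho> fs F y
    using S4[OF eh[OF that(1)], where g=eg and z=y] eg[OF that] that
    by (simp add: sig_simp Cons_map_upt del: upt_Suc)
  then show ?thesis unfolding kpcomp_def by blast
qed

section \<open>Substitution of computed values for the numerical arguments\<close>

lemma kleene_var:
  assumes "k < n"
  shows "\<exists>e. \<forall>xs fs F. length xs = n \<longrightarrow> length fs = b \<longrightarrow>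
    kleene e xs fs [F, exists2] (xs ! k)"
proof -
  let ?s = "list_encode [n, b, 2]"
  have "kleene (list_encode [6, ?s, 0, k, list_encode [3, ?s]]) xs fs [F, exists2] (xs ! k)"
    if "length xs = n" "length fs = b" for xs fs F
  proof -
    let ?ys = "take k xs @ drop (Suc k) xs"
    have "Suc (length ?ys) = n" using that assms by simp
    then have "kleene (list_encode [3, ?s]) (to_front k xs) fs [F, exists2] (xs ! k)"
      using S3[of "xs ! k" ?ys fs "[F, exists2]"] that by (simp add: to_front_def sig_simp)
    from S6_0[OF _ this] show ?thesis using that assms by (simp add: sig_simp)
  qed
  then show ?thesis by blast
qed

text \<open>S4 can only prepend a value; it cannot overwrite the old arguments. So the values are
  pushed one by one, \<open>\<sigma> 0\<close> last, in front of the original arguments. Each is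
  computed in the presence of some number \<open>k\<close> of values already pushed, which its index
  has to skip.\<close>

lemma kleene_push:
  assumes "\<And>i k. i < c \<Longrightarrow> \<exists>e. \<forall>ps \<rho> fs F. length ps = k \<longrightarrow> length fs = b \<longrightarrow>
      kleene e (ps @ map \<rho> [0..<a]) fs [F, exists2] (\<sigma> i \<rho> fs F)"
  shows "\<exists>e'. \<forall>\<rho> fs F y. length fs = b \<longrightarrow>
      kleene e (map (\<lambda>i. \<sigma> i \<rho> fs F) [0..<c] @ map \<rho> [0..<a]) fs [F, exists2] y \<longrightarrow>
      kleene e' (map \<rho> [0..<a]) fs [F, exists2] y"
  using assms
proof (induction c arbitrary: \<sigma> e)
  case 0
  then show ?case by auto
next
  case (Suc c)
  obtain h where h: "kleene h (ps @ map \<rho> [0..<a]) fs [F, exists2] (\<sigma> 0 \<rho> fs F)"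
    if "length ps = c" "length fs = b" for ps \<rho> fs F using Suc.prems[of 0 c] by blast
  let ?e = "list_encode [4, list_encode [c + a, b, 2], e, h]"
  obtain e' where e': "kleene e' (map \<rho> [0..<a]) fs [F, exists2] y"
    if "length fs = b"
      "kleene ?e (map (\<lambda>i. \<sigma> (Suc i) \<rho> fs F) [0..<c] @ map \<rho> [0..<a]) fs [F, exists2] y"
    for \<rho> fs F y
    using Suc.IH[of "\<lambda>i. \<sigma> (Suc i)" ?e] Suc.prems by (metis Suc_mono)
  have "kleene e' (map \<rho> [0..<a]) fs [F, exists2] y"
    if "length fs = b"
      "kleene e (map (\<lambda>i. \<sigma> i \<rho> fs F) [0..<Suc c] @ map \<rho> [0..<a]) fs [F, exists2] y"
    for \<rho> fs F y
  proof (rule e'[OF that(1)])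
    let ?ps = "map (\<lambda>i. \<sigma> (Suc i) \<rho> fs F) [0..<c]"
    have "kleene h (?ps @ map \<rho> [0..<a]) fs [F, exists2] (\<sigma> 0 \<rho> fs F)"
      using h that by simp
    from S4[OF this, of e y] that
    show "kleene ?e (?ps @ map \<rho> [0..<a]) fs [F, exists2] y"
      by (simp add: sig_simp map_upt_Suc del: upt_Suc)
  qed
  then show ?case by blast
qed

text \<open>S9 runs an index on an initial part of each argument list, so fetching the constant
  \<open>e\<close> by S2 and passing it to S9 discards the remaining numerical arguments.\<close>

lemma kleene_drop_suffix:
  "\<exists>e'. \<forall>xs ys fs F y. length xs = n \<longrightarrow> length ys = m \<longrightarrow> length fs = b \<longrightarrow>
      kleene e xs fs [F, exists2] y \<longrightarrow> kleene e' (xs @ ys) fs [F, exists2] y"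
proof -
  let ?g = "list_encode [9, list_encode [Suc (n + m), b, 2], list_encode [n, b, 2]]"
  let ?h = "list_encode [2, list_encode [n + m, b, 2], e]"
  have "kleene (list_encode [4, list_encode [n + m, b, 2], ?g, ?h]) (xs @ ys) fs [F, exists2] y"
    if "length xs = n" "length ys = m" "length fs = b" "kleene e xs fs [F, exists2] y"
    for xs ys fs F y
  proof -
    have 1: "kleene ?g (e # xs @ ys) fs [F, exists2] y"
      using S9[OF that(4), of ys "[]" "[]"] that by (simp add: sig_simp)
    have 2: "kleene ?h (xs @ ys) fs [F, exists2] e"
      using S2[of "xs @ ys" fs "[F, exists2]" e] that by (simp add: sig_simp)
    show ?thesis using S4[OF 2 1] that by (simp add: sig_simp)
  qed
  then show ?thesis by blast
qed

lemma kleene_subst: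
  assumes "\<And>i k. i < c \<Longrightarrow> \<exists>e. \<forall>ps \<rho> fs F. length ps = k \<longrightarrow> length fs = b \<longrightarrow>
      kleene e (ps @ map \<rho> [0..<a]) fs [F, exists2] (\<sigma> i \<rho> fs F)"
  shows "\<exists>e'. \<forall>\<rho> fs F y. length fs = b \<longrightarrow>
      kleene e (map (\<lambda>i. \<sigma> i \<rho> fs F) [0..<c]) fs [F, exists2] y \<longrightarrow>
      kleene e' (map \<rho> [0..<a]) fs [F, exists2] y"
proof -
  obtain e9 where e9: "kleene e9 (xs @ ys) fs [F, exists2] y"
    if "length xs = c" "length ys = a" "length fs = b" "kleene e xs fs [F, exists2] y"
    for xs ys fs F y
    using kleene_drop_suffix[of c a b e] by blast
  obtain e' where e': "kleene e' (map \<rho> [0..<a]) fs [F, exists2] y"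
    if "length fs = b"
      "kleene e9 (map (\<lambda>i. \<sigma> i \<rho> fs F) [0..<c] @ map \<rho> [0..<a]) fs [F, exists2] y"
    for \<rho> fs F y
    using kleene_push[of c b a \<sigma> e9, OF assms] by blast
  have "kleene e' (map \<rho> [0..<a]) fs [F, exists2] y"
    if "length fs = b" "kleene e (map (\<lambda>i. \<sigma> i \<rho> fs F) [0..<c]) fs [F, exists2] y" for \<rho> fs F y
    by (rule e'[OF that(1)], rule e9) (use that in auto)
  then show ?thesis by blast
qed

text \<open>Supplies the hypothesis of \<open>kleene_subst\<close> for arbitrary computable
  functions. There is no circularity: the substitution made here inserts only projections, for which
  \<open>kleene_var\<close> copes with a prefix directly.\<close>

lemma kcomp_drop_prefix:
  assumes "kcomp a b \<phi>"
  shows "\<exists>e. \<forall>ps \<rho> fs F. length ps = k \<longrightarrow> length fs = b \<longrightarrow>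
      kleene e (ps @ map \<rho> [0..<a]) fs [F, exists2] (\<phi> \<rho> fs F)"
proof -
  obtain e where e: "kleene e (map \<rho> [0..<a]) fs [F, exists2] (\<phi> \<rho> fs F)"
    if "length fs = b" for \<rho> fs F using assms unfolding kcomp_iff by blast
  have "\<exists>e'. \<forall>\<rho>' fs F y. length fs = b \<longrightarrow>
      kleene e (map (\<lambda>i. \<rho>' (k + i)) [0..<a]) fs [F, exists2] y \<longrightarrow>
      kleene e' (map \<rho>' [0..<k + a]) fs [F, exists2] y"
  proof (rule kleene_subst)
    fix i j assume "i < a"
    then obtain e where e: "kleene e xs fs [F, exists2] (xs ! (j + (k + i)))"
      if "length xs = j + (k + a)" "length fs = b" for xs fs F
      using kleene_var[of "j + (k + i)" "j + (k + a)" b] by auto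
    have "kleene e (ps @ map \<rho> [0..<k + a]) fs [F, exists2] (\<rho> (k + i))"
      if "length ps = j" "length fs = b" for ps \<rho> fs F
      using e[of "ps @ map \<rho> [0..<k + a]" fs F] that \<open>i < a\<close> by (simp add: nth_append)
    then show "\<exists>e. \<forall>ps \<rho> fs F. length ps = j \<longrightarrow> length fs = b \<longrightarrow>
        kleene e (ps @ map \<rho> [0..<k + a]) fs [F, exists2] (\<rho> (k + i))" by blast
  qed
  then obtain e' where e': "kleene e' (map \<rho>' [0..<k + a]) fs [F, exists2] y"
    if "length fs = b" "kleene e (map (\<lambda>i. \<rho>' (k + i)) [0..<a]) fs [F, exists2] y" for \<rho>' fs F y
    by blast
  have "kleene e' (ps @ map \<rho> [0..<a]) fs [F, exists2] (\<phi> \<rho> fs F)"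
    if "length ps = k" "length fs = b" for ps \<rho> fs F
  proof -
    let ?\<rho> = "\<lambda>i. (ps @ map \<rho> [0..<a]) ! i"
    have 1: "map (\<lambda>i. ?\<rho> (k + i)) [0..<a] = map \<rho> [0..<a]"
      using that by (auto simp: nth_append)
    have 2: "map ?\<rho> [0..<k + a] = ps @ map \<rho> [0..<a]"
      using that map_nth[of "ps @ map \<rho> [0..<a]"] by simp
    show ?thesis using e'[of fs ?\<rho> F "\<phi> \<rho> fs F"] e[of fs \<rho> F] that(2) unfolding 1 2 by blast
  qed
  then show ?thesis by blast
qed

lemma kpcomp_subst:
  assumes "kpcomp c b R" "\<And>i. i < c \<Longrightarrow> kcomp a b (\<sigma> i)"
  shows "kpcomp a b (\<lambda>\<rho> fs F y. R (\<lambda>i. \<sigma> i \<rho> fs F) fs F y)"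
proof -
  obtain e where e: "kleene e (map \<rho> [0..<c]) fs [F, exists2] y"
    if "length fs = b" "R \<rho> fs F y" for \<rho> fs F y using assms(1) unfolding kpcomp_def by blast
  obtain e' where e': "kleene e' (map \<rho> [0..<a]) fs [F, exists2] y"
    if "length fs = b" "kleene e (map (\<lambda>i. \<sigma> i \<rho> fs F) [0..<c]) fs [F, exists2] y" for \<rho> fs F y
    using kleene_subst[of c b a \<sigma> e] kcomp_drop_prefix[OF assms(2)] by blast
  show ?thesis unfolding kpcomp_def using e e' by blast
qed

lemma kcomp_subst:
  assumes "kcomp c b \<phi>" "\<And>i. i < c \<Longrightarrow> kcomp a b (\<sigma> i)"
  shows "kcomp a b (\<lambda>\<rho> fs F. \<phi> (\<lambda>i. \<sigma> i \<rho> fs F) fs F)"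
  using kpcomp_subst[OF assms(1)[unfolded kcomp_def] assms(2)] unfolding kcomp_def by simp

lemma kcomp_var: "i < a \<Longrightarrow> kcomp a b (\<lambda>\<rho> fs F. \<rho> i)"
proof -
  assume i: "i < a"
  then obtain e where e: "kleene e xs fs [F, exists2] (xs ! i)"
    if "length xs = a" "length fs = b" for xs fs F
    using kleene_var[of i a b] by blast
  have "kleene e (map \<rho> [0..<a]) fs [F, exists2] (\<rho> i)" if "length fs = b" for \<rho> fs F
    using e[of "map \<rho> [0..<a]" fs F] that i by simp
  then show ?thesis unfolding kcomp_iff by blast
qed

lemma kcomp_subst1:
  assumes "kcomp (Suc a) b (\<lambda>\<rho> fs F. \<phi> (\<rho> 0) (\<lambda>i. \<rho> (Suc i)) fs F)" "kcomp a b \<psi>"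
  shows "kcomp a b (\<lambda>\<rho> fs F. \<phi> (\<psi> \<rho> fs F) \<rho> fs F)"
  using kpcomp_let[OF assms(2) assms(1)[unfolded kcomp_def]] unfolding kcomp_def by simp

lemma kcomp_Suc:
  assumes "kcomp a b \<phi>" shows "kcomp a b (\<lambda>\<rho> fs F. Suc (\<phi> \<rho> fs F))"
proof (rule kcomp_subst1[OF _ assms])
  have "kleene (list_encode [1, list_encode [Suc a, b, 2]]) (map \<rho> [0..<Suc a]) fs [F, exists2]
      (Suc (\<rho> 0))" if "length fs = b" for \<rho> fs F
    using S1[of "\<rho> 0" "map (\<lambda>i. \<rho> (Suc i)) [0..<a]" fs "[F, exists2]"] that
    by (simp add: sig_simp map_upt_Suc del: upt_Suc)
  then show "kcomp (Suc a) b (\<lambda>\<rho> fs F. Suc (\<rho> 0))" unfolding kcomp_iff by blast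
qed

section \<open>Recursion, case distinction and calls of the oracles\<close>

lemma kcomp_rec:
  assumes "kcomp a b n" "kcomp a b g"
    "kcomp (Suc (Suc a)) b (\<lambda>\<rho> fs F. h (\<rho> 0) (\<rho> 1) (\<lambda>i. \<rho> (Suc (Suc i))) fs F)"
  shows "kcomp a b (\<lambda>\<rho> fs F. rec_nat (g \<rho> fs F) (\<lambda>m y. h m y \<rho> fs F) (n \<rho> fs F))"
proof (rule kcomp_subst1[OF _ assms(1)])
  obtain eg where eg: "kleene eg (map \<rho> [0..<a]) fs [F, exists2] (g \<rho> fs F)"
    if "length fs = b" for \<rho> fs F using assms(2) unfolding kcomp_iff by blast
  obtain eh where eh: "kleene eh (map \<rho> [0..<Suc (Suc a)]) fs [F, exists2]
       (h (\<rho> 0) (\<rho> 1) (\<lambda>i. \<rho> (Suc (Suc i))) fs F)"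
    if "length fs = b" for \<rho> fs F using assms(3) unfolding kcomp_iff by blast
  let ?e = "list_encode [5, list_encode [Suc a, b, 2], eg, eh]"
  have *: "kleene ?e (m # map \<rho> [0..<a]) fs [F, exists2]
      (rec_nat (g \<rho> fs F) (\<lambda>m y. h m y \<rho> fs F) m)" if b: "length fs = b" for \<rho> fs F m
  proof (induction m)
    case 0
    show ?case using S5_0[OF eg[OF b], where h=eh] b by (simp add: sig_simp)
  next
    case (Suc m)
    let ?y = "rec_nat (g \<rho> fs F) (\<lambda>m y. h m y \<rho> fs F) m"
    have "kleene eh (m # ?y # map \<rho> [0..<a]) fs [F, exists2] (h m ?y \<rho> fs F)"
      using eh[OF b, of "case_nat m (case_nat ?y \<rho>)"]
      by (simp add: map_upt_Suc del: upt_Suc)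
    from S5_Suc[OF _ this, where g=eg] Suc b show ?case by (simp add: sig_simp)
  qed
  have "kleene ?e (map \<rho> [0..<Suc a]) fs [F, exists2]
      (rec_nat (g (\<lambda>i. \<rho> (Suc i)) fs F) (\<lambda>m y. h m y (\<lambda>i. \<rho> (Suc i)) fs F) (\<rho> 0))"
    if "length fs = b" for \<rho> fs F
    using *[OF that, of "\<rho> 0" "\<lambda>i. \<rho> (Suc i)"] by (simp add: map_upt_Suc del: upt_Suc)
  then show "kcomp (Suc a) b (\<lambda>\<rho> fs F. rec_nat (g (\<lambda>i. \<rho> (Suc i)) fs F)
      (\<lambda>m y. h m y (\<lambda>i. \<rho> (Suc i)) fs F) (\<rho> 0))"
    unfolding kcomp_iff by blast
qed

text \<open>As for \<^const>\<open>exists2\<close>, the value 0 stands for truth.\<close>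

definition dec :: "nat \<Rightarrow> nat \<Rightarrow>
    ((nat \<Rightarrow> nat) \<Rightarrow> (nat \<Rightarrow> nat) list \<Rightarrow> ((nat \<Rightarrow> nat) \<Rightarrow> nat) \<Rightarrow> bool) \<Rightarrow> bool" where
  "dec a b P \<longleftrightarrow> kcomp a b (\<lambda>\<rho> fs F. if P \<rho> fs F then 0 else 1)"

text \<open>
  Scheme S5 evaluates its base case \<open>g\<close> even if the recursion argument is 1, so only the second
  branch may be partial.
\<close>

lemma kpcomp_if:
  assumes "dec a b P" "kcomp a b g" "kpcomp (Suc (Suc a)) b R"
  shows "kpcomp a b (\<lambda>\<rho> fs F y. if P \<rho> fs F then y = g \<rho> fs F
    else R (case_nat 0 (case_nat (g \<rho> fs F) \<rho>)) fs F y)"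
proof -
  obtain eg where eg: "kleene eg (map \<rho> [0..<a]) fs [F, exists2] (g \<rho> fs F)"
    if "length fs = b" for \<rho> fs F using assms(2) unfolding kcomp_iff by blast
  obtain eh where eh: "kleene eh (map \<rho> [0..<Suc (Suc a)]) fs [F, exists2] y"
    if "length fs = b" "R \<rho> fs F y" for \<rho> fs F y using assms(3) unfolding kpcomp_def by blast
  let ?e = "list_encode [5, list_encode [Suc a, b, 2], eg, eh]"
  \<comment> \<open>The graph of the S5 recursion at the arguments 0 and 1. At 1, the step index
    sees the predecessor 0 and the base value in front of the parameters.\<close>
  define Q where "Q = (\<lambda>\<rho> fs F y. \<rho> 0 = 0 \<and> y = g (\<lambda>i. \<rho> (Suc i)) fs F \<or>
    \<rho> 0 = 1 \<and> R (case_nat 0 (case_nat (g (\<lambda>i. \<rho> (Suc i)) fs F) (\<lambda>i. \<rho> (Suc i)))) fs F y)"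
  have "kleene ?e (map \<rho> [0..<Suc a]) fs [F, exists2] y"
    if b: "length fs = b" and Q: "Q \<rho> fs F y" for \<rho> fs F y
  proof -
    let ?\<rho> = "\<lambda>i. \<rho> (Suc i)"
    have 0: "kleene ?e (0 # map ?\<rho> [0..<a]) fs [F, exists2] (g ?\<rho> fs F)"
      using S5_0[OF eg[OF b], where h=eh] b by (simp add: sig_simp)
    show ?thesis using Q unfolding Q_def
    proof (elim disjE conjE, goal_cases)
      case 1
      then show ?case using 0 by (simp add: map_upt_Suc del: upt_Suc)
    next
      case 2
      have "kleene eh (0 # g ?\<rho> fs F # map ?\<rho> [0..<a]) fs [F, exists2] y"
        using eh[OF b 2(2)] by (simp add: map_upt_Suc del: upt_Suc)
      from S5_Suc[OF _ this, where g=eg] 0 2(1) b show ?case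
        by (simp add: sig_simp map_upt_Suc del: upt_Suc)
    qed
  qed
  then have "kpcomp (Suc a) b Q" unfolding kpcomp_def by blast
  from kpcomp_let[OF assms(1)[unfolded dec_def] this]
  have "kpcomp a b (\<lambda>\<rho> fs F y. Q (case_nat (if P \<rho> fs F then 0 else 1) \<rho>) fs F y)" .
  moreover have "(\<lambda>\<rho> fs F y. Q (case_nat (if P \<rho> fs F then 0 else 1) \<rho>) fs F y) =
    (\<lambda>\<rho> fs F y. if P \<rho> fs F then y = g \<rho> fs F
      else R (case_nat 0 (case_nat (g \<rho> fs F) \<rho>)) fs F y)"
    by (intro ext) (simp add: Q_def)
  ultimately show ?thesis by simp
qed

lemma kcomp_oracle1:
  assumes "i < b" "kcomp a b \<phi>"
  shows "kcomp a b (\<lambda>\<rho> fs F. (fs ! i) (\<phi> \<rho> fs F))"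
proof (rule kcomp_subst1[OF _ assms(2)])
  let ?s = "list_encode [Suc a, b, 2]"
  have "kleene (list_encode [6, ?s, 1, i, list_encode [7, ?s]]) (map \<rho> [0..<Suc a]) fs
      [F, exists2] ((fs ! i) (\<rho> 0))" if b: "length fs = b" for \<rho> fs F
  proof -
    let ?gs = "take i fs @ drop (Suc i) fs"
    have "Suc (length ?gs) = b" using b assms(1) by simp
    then have "kleene (list_encode [7, ?s]) (map \<rho> [0..<Suc a]) (to_front i fs) [F, exists2]
        ((fs ! i) (\<rho> 0))"
      using S7[of "\<rho> 0" "map (\<lambda>i. \<rho> (Suc i)) [0..<a]" "fs ! i" ?gs "[F, exists2]"]
      by (simp add: to_front_def sig_simp map_upt_Suc del: upt_Suc)
    from S6_1[OF _ this] show ?thesis using b assms(1) by (simp add: sig_simp del: upt_Suc)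
  qed
  then show "kcomp (Suc a) b (\<lambda>\<rho> fs F. (fs ! i) (\<rho> 0))" unfolding kcomp_iff by blast
qed

lemma kcomp_oracle2:
  assumes "kcomp (Suc a) b (\<lambda>\<rho> fs F. h (\<rho> 0) (\<lambda>i. \<rho> (Suc i)) fs F)"
  shows "kcomp a b (\<lambda>\<rho> fs F. F (\<lambda>n. h n \<rho> fs F))"
proof -
  obtain e where e: "kleene e (map \<rho> [0..<Suc a]) fs [F, exists2] (h (\<rho> 0) (\<lambda>i. \<rho> (Suc i)) fs F)"
    if "length fs = b" for \<rho> fs F using assms(1) unfolding kcomp_iff by blast
  have "kleene (list_encode [8, list_encode [a, b, 2], 2, e]) (map \<rho> [0..<a]) fs [F, exists2]
      (F (\<lambda>n. h n \<rho> fs F))" if b: "length fs = b" for \<rho> fs F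
  proof -
    have "kleene e (n # map \<rho> [0..<a]) fs [F, exists2] (h n \<rho> fs F)" for n
      using e[OF b, of "case_nat n \<rho>"] by (simp add: map_upt_Suc del: upt_Suc)
    from S8[OF this] show ?thesis using b by (simp add: sig_simp)
  qed
  then show ?thesis unfolding kcomp_iff by blast
qed

text \<open>S8 applies the first type 2 argument, but \<open>exists2\<close> is the second. S6 swaps
  the two before the call, and \<open>?e1\<close> swaps them back for the body, whose index expects
  the original order.\<close>

lemma kcomp_exists2:
  assumes "kcomp (Suc a) b (\<lambda>\<rho> fs F. h (\<rho> 0) (\<lambda>i. \<rho> (Suc i)) fs F)"
  shows "kcomp a b (\<lambda>\<rho> fs F. exists2 (\<lambda>n. h n \<rho> fs F))"
proof -
  obtain e where e: "kleene e (map \<rho> [0..<Suc a]) fs [F, exists2] (h (\<rho> 0) (\<lambda>i. \<rho> (Suc i)) fs F)"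
    if "length fs = b" for \<rho> fs F using assms(1) unfolding kcomp_iff by blast
  let ?e1 = "list_encode [6, list_encode [Suc a, b, 2], 2, 1, e]"
  let ?e2 = "list_encode [8, list_encode [a, b, 2], 2, ?e1]"
  have "kleene (list_encode [6, list_encode [a, b, 2], 2, 1, ?e2]) (map \<rho> [0..<a]) fs [F, exists2]
      (exists2 (\<lambda>n. h n \<rho> fs F))" if b: "length fs = b" for \<rho> fs F
  proof -
    have "kleene ?e1 (n # map \<rho> [0..<a]) fs [exists2, F] (h n \<rho> fs F)" for n
    proof -
      have "kleene e (n # map \<rho> [0..<a]) fs (to_front 1 [exists2, F]) (h n \<rho> fs F)"
        using e[OF b, of "case_nat n \<rho>"] by (simp add: to_front_def map_upt_Suc del: upt_Suc)
      from S6_2[OF _ this] show ?thesis using b by (simp add: sig_simp)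
    qed
    from S8[OF this]
    have "kleene ?e2 (map \<rho> [0..<a]) fs (to_front 1 [F, exists2]) (exists2 (\<lambda>n. h n \<rho> fs F))"
      using b by (simp add: sig_simp to_front_def)
    from S6_2[OF _ this] show ?thesis using b by (simp add: sig_simp)
  qed
  then show ?thesis unfolding kcomp_iff by blast
qed

lemma kcomp_if:
  assumes "dec a b P" "kcomp a b g" "kcomp a b h"
  shows "kcomp a b (\<lambda>\<rho> fs F. if P \<rho> fs F then g \<rho> fs F else h \<rho> fs F)"
proof -
  have h: "kcomp (Suc (Suc a)) b (\<lambda>\<rho> fs F. h (\<lambda>i. \<rho> (Suc (Suc i))) fs F)"
    by (rule kcomp_subst[OF assms(3)]) (rule kcomp_var, simp)
  have "kcomp a b (\<lambda>\<rho> fs F. rec_nat (g \<rho> fs F) (\<lambda>m y. h \<rho> fs F) (if P \<rho> fs F then 0 else 1))"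
    by (rule kcomp_rec[OF assms(1)[unfolded dec_def] assms(2) h])
  moreover have "(\<lambda>\<rho> fs F. rec_nat (g \<rho> fs F) (\<lambda>m y. h \<rho> fs F) (if P \<rho> fs F then 0 else 1)) =
    (\<lambda>\<rho> fs F. if P \<rho> fs F then g \<rho> fs F else h \<rho> fs F)" by (intro ext) simp
  ultimately show ?thesis by simp
qed

section \<open>Decidable predicates: connectives and numerical quantifiers\<close>

lemma dec_not: "dec a b P \<Longrightarrow> dec a b (\<lambda>\<rho> fs F. \<not> P \<rho> fs F)"
  unfolding dec_def
  by (rule back_subst[of "kcomp a b", OF kcomp_if[OF _ kcomp_const[of _ _ 1] kcomp_const[of _ _ 0]]])
     (auto simp: dec_def fun_eq_iff)

lemma dec_if:
  assumes "dec a b P" "dec a b Q" "dec a b R"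
  shows "dec a b (\<lambda>\<rho> fs F. if P \<rho> fs F then Q \<rho> fs F else R \<rho> fs F)"
  unfolding dec_def
  by (rule back_subst[of "kcomp a b", OF kcomp_if[OF assms(1) assms(2,3)[unfolded dec_def]]])
     (intro ext, simp)

lemma dec_const: "dec a b (\<lambda>\<rho> fs F. c)"
  unfolding dec_def by (rule kcomp_const)

lemma dec_conj:
  assumes "dec a b P" "dec a b Q" shows "dec a b (\<lambda>\<rho> fs F. P \<rho> fs F \<and> Q \<rho> fs F)"
  by (rule back_subst[of "dec a b", OF dec_if[OF assms dec_const[of _ _ False]]])
     (intro ext, simp)

lemma dec_disj:
  assumes "dec a b P" "dec a b Q" shows "dec a b (\<lambda>\<rho> fs F. P \<rho> fs F \<or> Q \<rho> fs F)"
  by (rule back_subst[of "dec a b", OF dec_if[OF assms(1) dec_const[of _ _ True] assms(2)]])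
     (intro ext, simp)

lemma dec_imp:
  assumes "dec a b P" "dec a b Q" shows "dec a b (\<lambda>\<rho> fs F. P \<rho> fs F \<longrightarrow> Q \<rho> fs F)"
  by (rule back_subst[of "dec a b", OF dec_if[OF assms dec_const[of _ _ True]]])
     (intro ext, simp)

lemma dec_ex:
  assumes "dec (Suc a) b (\<lambda>\<rho> fs F. P (\<rho> 0) (\<lambda>i. \<rho> (Suc i)) fs F)"
  shows "dec a b (\<lambda>\<rho> fs F. \<exists>m. P m \<rho> fs F)"
proof -
  have *: "(\<lambda>\<rho> fs F. exists2 (\<lambda>n. if P n \<rho> fs F then 0 else 1)) =
      (\<lambda>\<rho> fs F. if \<exists>m. P m \<rho> fs F then 0 else 1)"
    by (intro ext) (simp add: exists2_def)
  show ?thesis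
    using kcomp_exists2[of a b "\<lambda>n \<rho> fs F. if P n \<rho> fs F then 0 else 1"] assms
    unfolding dec_def * .
qed

lemma dec_all:
  assumes "dec (Suc a) b (\<lambda>\<rho> fs F. P (\<rho> 0) (\<lambda>i. \<rho> (Suc i)) fs F)"
  shows "dec a b (\<lambda>\<rho> fs F. \<forall>m. P m \<rho> fs F)"
  using dec_not[OF dec_ex[of a b "\<lambda>m \<rho> fs F. \<not> P m \<rho> fs F", OF dec_not[OF assms]]] by simp

text \<open>The default 0 makes the search a total function, as \<open>kcomp\<close>
  requires.\<close>

definition mu :: "(nat \<Rightarrow> bool) \<Rightarrow> nat" where
  "mu P = (if \<exists>n. P n then LEAST n. P n else 0)"

lemma mu_eqI: "P n \<Longrightarrow> (\<And>m. P m \<Longrightarrow> m = n) \<Longrightarrow> mu P = n"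
  unfolding mu_def by (metis LeastI)

lemma muI: "P n \<Longrightarrow> P (mu P)"
  unfolding mu_def by (auto intro: LeastI)

text \<open>
  Recursion by self-application: \<open>G\<close> is an index with \<open>{G}(z, n, xs) = n\<close> if \<open>P n\<close>, and
  \<open>{G}(z, n, xs) = {z}(z, n + 1, xs)\<close> by S9 otherwise; the search is \<open>{G}(G, 0, xs)\<close>.
\<close>

lemma kpcomp_search:
  assumes P: "dec (Suc a) b (\<lambda>\<rho> fs F. P (\<rho> 0) (\<lambda>i. \<rho> (Suc i)) fs F)"
  shows "kpcomp a b (\<lambda>\<rho> fs F y. (\<exists>n. P n \<rho> fs F) \<and> y = (LEAST n. P n \<rho> fs F))"
proof -
  have P': "dec (Suc (Suc a)) b (\<lambda>\<rho> fs F. P (\<rho> 1) (\<lambda>i. \<rho> (Suc (Suc i))) fs F)"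
    unfolding dec_def
    using kcomp_subst[OF P[unfolded dec_def], of "Suc (Suc a)" "\<lambda>i \<rho> fs F. \<rho> (Suc i)"]
    by (simp add: kcomp_var)
  have "kpcomp (Suc (Suc (Suc a))) b (\<lambda>\<rho> fs F y.
      kleene (\<rho> 0) (map (\<lambda>i. \<rho> (Suc i)) [0..<Suc (Suc a)]) fs [F, exists2] y)"
  proof -
    let ?e = "list_encode [9, list_encode [Suc (Suc (Suc a)), b, 2], list_encode [Suc (Suc a), b, 2]]"
    have "kleene ?e (map \<rho> [0..<Suc (Suc (Suc a))]) fs [F, exists2] y"
      if "length fs = b"
        "kleene (\<rho> 0) (map (\<lambda>i. \<rho> (Suc i)) [0..<Suc (Suc a)]) fs [F, exists2] y" for \<rho> fs F y
      using S9[OF that(2), of "[]" "[]" "[]"] that(1)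
      by (simp add: sig_simp map_upt_Suc del: upt_Suc)
    then show ?thesis unfolding kpcomp_def by blast
  qed
  \<comment> \<open>In the second branch of \<open>kpcomp_if\<close>, positions 0 and 1 hold the
    recursion data, so the index \<open>z\<close> is at 2 and the counter at 3. The new arguments
    are \<open>z\<close> as the index for S9, then \<open>z\<close> again, the next counter value
    and the parameters.\<close>
  moreover define \<sigma> :: "nat \<Rightarrow> (nat \<Rightarrow> nat) \<Rightarrow> (nat \<Rightarrow> nat) list \<Rightarrow> ((nat \<Rightarrow> nat) \<Rightarrow> nat) \<Rightarrow> nat"
    where "\<sigma> = (\<lambda>i \<rho> fs F. if i = 0 \<or> i = 1 then \<rho> 2 else if i = 2 then Suc (\<rho> 3) else \<rho> (Suc i))"
  have "kcomp (Suc (Suc (Suc (Suc a)))) b (\<sigma> i)" if "i < Suc (Suc (Suc a))" for i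
    using that by (cases "i = 0 \<or> i = 1"; cases "i = 2") (auto simp: \<sigma>_def kcomp_var kcomp_Suc)
  ultimately have "kpcomp (Suc (Suc (Suc (Suc a)))) b (\<lambda>\<rho> fs F y. kleene (\<sigma> 0 \<rho> fs F)
      (map (\<lambda>i. \<sigma> (Suc i) \<rho> fs F) [0..<Suc (Suc a)]) fs [F, exists2] y)"
    by (rule kpcomp_subst)
  then have "kpcomp (Suc (Suc (Suc (Suc a)))) b (\<lambda>\<rho> fs F y. kleene (\<rho> 2)
      (\<rho> 2 # Suc (\<rho> 3) # map (\<lambda>i. \<rho> (i + 4)) [0..<a]) fs [F, exists2] y)"
    by (simp add: \<sigma>_def map_upt_Suc numeral_eq_Suc del: upt_Suc)
  from kpcomp_if[OF P' kcomp_var[of 1] this]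
  have "kpcomp (Suc (Suc a)) b (\<lambda>\<rho> fs F y.
      if P (\<rho> 1) (\<lambda>i. \<rho> (Suc (Suc i))) fs F then y = \<rho> 1
      else kleene (\<rho> 0) (\<rho> 0 # Suc (\<rho> 1) # map (\<lambda>i. \<rho> (Suc (Suc i))) [0..<a]) fs [F, exists2] y)"
    by (simp add: numeral_eq_Suc cong: if_cong)
  then obtain G where G: "kleene G (map \<rho> [0..<Suc (Suc a)]) fs [F, exists2] y"
    if "length fs = b" "if P (\<rho> 1) (\<lambda>i. \<rho> (Suc (Suc i))) fs F then y = \<rho> 1
      else kleene (\<rho> 0) (\<rho> 0 # Suc (\<rho> 1) # map (\<lambda>i. \<rho> (Suc (Suc i))) [0..<a]) fs [F, exists2] y"
    for \<rho> fs F y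
    unfolding kpcomp_def by blast
  have G': "kleene G (z # n # map \<rho> [0..<a]) fs [F, exists2] y"
    if "length fs = b" "if P n \<rho> fs F then y = n
      else kleene z (z # Suc n # map \<rho> [0..<a]) fs [F, exists2] y"
    for z n \<rho> fs F y
    using G[of fs "case_nat z (case_nat n \<rho>)" F y] that
    by (simp add: map_upt_Suc del: upt_Suc)
  have *: "kleene G (G # n # map \<rho> [0..<a]) fs [F, exists2] (LEAST n. P n \<rho> fs F)"
    if b: "length fs = b" and ex: "\<exists>n. P n \<rho> fs F" and le: "n \<le> (LEAST n. P n \<rho> fs F)" for n \<rho> fs F
    using le
  \<comment> \<open>The computation at \<open>n\<close> calls the one at \<open>Suc n\<close>, so
    derivations are built from the least witness downwards.\<close>
  proof (induction rule: inc_induct)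
    case base
    show ?case by (rule G'[OF b]) (use LeastI_ex[OF ex] in auto)
  next
    case (step n)
    show ?case by (rule G'[OF b]) (use step not_less_Least[of n] in auto)
  qed
  have "kpcomp (Suc (Suc a)) b (\<lambda>\<rho> fs F y. kleene G (map \<rho> [0..<Suc (Suc a)]) fs [F, exists2] y)"
    unfolding kpcomp_def by blast
  from kpcomp_let[OF kcomp_const[of _ _ 0] kpcomp_let[OF kcomp_const[of _ _ G] this]]
  have "kpcomp a b (\<lambda>\<rho> fs F y. kleene G (G # 0 # map \<rho> [0..<a]) fs [F, exists2] y)"
    by (simp add: map_upt_Suc del: upt_Suc)
  then show ?thesis unfolding kpcomp_def using * by blast
qed

text \<open>Whether a witness exists is decided first. The negated test puts the possibly divergent
  search into the second branch, where \<open>kpcomp_if\<close> allows partiality.\<close>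

lemma kcomp_mu:
  assumes P: "dec (Suc a) b (\<lambda>\<rho> fs F. P (\<rho> 0) (\<lambda>i. \<rho> (Suc i)) fs F)"
  shows "kcomp a b (\<lambda>\<rho> fs F. mu (\<lambda>n. P n \<rho> fs F))"
proof -
  have 1: "kpcomp (Suc (Suc a)) b (\<lambda>\<rho> fs F y. (\<exists>n. P n (\<lambda>i. \<rho> (Suc (Suc i))) fs F) \<and>
      y = (LEAST n. P n (\<lambda>i. \<rho> (Suc (Suc i))) fs F))"
    by (rule kpcomp_subst[OF kpcomp_search[OF P], of "Suc (Suc a)" "\<lambda>i \<rho> fs F. \<rho> (Suc (Suc i))"])
       (simp add: kcomp_var)
  have "kpcomp a b (\<lambda>\<rho> fs F y. y = mu (\<lambda>n. P n \<rho> fs F))"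
    by (rule back_subst[of "kpcomp a b",
          OF kpcomp_if[OF dec_not[OF dec_ex[OF P]] kcomp_const[of _ _ 0] 1]])
       (intro ext, auto simp: mu_def)
  then show ?thesis unfolding kcomp_def .
qed

section \<open>Arithmetic on codes of rationals\<close>

lemma kcomp_add:
  assumes "kcomp a b \<phi>" "kcomp a b \<psi>"
  shows "kcomp a b (\<lambda>\<rho> fs F. \<phi> \<rho> fs F + \<psi> \<rho> fs F)"
proof -
  have "rec_nat n (\<lambda>m y. Suc y) m = m + n" for m n :: nat by (induction m) auto
  with kcomp_rec[OF assms, of "\<lambda>m y \<rho> fs F. Suc y"] show ?thesis
    by (simp add: kcomp_Suc kcomp_var)
qed

lemma kcomp_mult:
  assumes "kcomp a b \<phi>" "kcomp a b \<psi>"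
  shows "kcomp a b (\<lambda>\<rho> fs F. \<phi> \<rho> fs F * \<psi> \<rho> fs F)"
proof -
  have 1: "rec_nat 0 (\<lambda>m y. n + y) m = m * n" for m n :: nat by (induction m) auto
  have "kcomp (Suc (Suc a)) b (\<lambda>\<rho> fs F. \<psi> (\<lambda>i. \<rho> (Suc (Suc i))) fs F)"
    by (rule kcomp_subst[OF assms(2)]) (simp add: kcomp_var)
  then have "kcomp a b (\<lambda>\<rho> fs F. rec_nat 0 (\<lambda>m y. \<psi> \<rho> fs F + y) (\<phi> \<rho> fs F))"
    by (intro kcomp_rec assms kcomp_const kcomp_add kcomp_var) simp_all
  then show ?thesis by (simp add: 1)
qed

lemma kcomp_power2:
  assumes "kcomp a b \<phi>" shows "kcomp a b (\<lambda>\<rho> fs F. 2 ^ \<phi> \<rho> fs F)"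
proof -
  have 1: "rec_nat 1 (\<lambda>m y. 2 * y) m = 2 ^ m" for m :: nat by (induction m) auto
  have "kcomp a b (\<lambda>\<rho> fs F. rec_nat 1 (\<lambda>m y. 2 * y) (\<phi> \<rho> fs F))"
    by (intro kcomp_rec assms kcomp_const kcomp_mult kcomp_var) simp
  then show ?thesis unfolding 1 .
qed

lemma kcomp_diff:
  assumes "kcomp a b \<phi>" "kcomp a b \<psi>"
  shows "kcomp a b (\<lambda>\<rho> fs F. \<phi> \<rho> fs F - \<psi> \<rho> fs F)"
proof -
  have 1: "rec_nat 0 (\<lambda>m y. m) m = m - 1" for m :: nat by (cases m) auto
  have 2: "rec_nat n (\<lambda>m y. y - 1) m = n - m" for m n :: nat by (induction m) auto
  have "kcomp (Suc (Suc a)) b (\<lambda>\<rho> fs F. rec_nat 0 (\<lambda>m y. m) (\<rho> 1))"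
    by (intro kcomp_rec kcomp_const kcomp_var) simp_all
  then have "kcomp a b (\<lambda>\<rho> fs F. rec_nat (\<phi> \<rho> fs F) (\<lambda>m y. rec_nat 0 (\<lambda>m y. m) y) (\<psi> \<rho> fs F))"
    by (rule kcomp_rec[OF assms(2,1)])
  then show ?thesis unfolding 1 2 .
qed

lemma dec_eq_0:
  assumes "kcomp a b \<phi>" shows "dec a b (\<lambda>\<rho> fs F. \<phi> \<rho> fs F = 0)"
proof -
  have 1: "rec_nat 0 (\<lambda>m y. 1) m = (if m = 0 then 0 else 1)" for m :: nat by (cases m) auto
  have "kcomp a b (\<lambda>\<rho> fs F. rec_nat 0 (\<lambda>m y. 1) (\<phi> \<rho> fs F))"
    by (intro kcomp_rec assms kcomp_const)
  then show ?thesis unfolding dec_def 1 .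
qed

lemma dec_le_nat:
  assumes "kcomp a b \<phi>" "kcomp a b \<psi>"
  shows "dec a b (\<lambda>\<rho> fs F. (\<phi> \<rho> fs F :: nat) \<le> \<psi> \<rho> fs F)"
  using dec_eq_0[OF kcomp_diff[OF assms]] by simp

lemma dec_less_nat:
  assumes "kcomp a b \<phi>" "kcomp a b \<psi>"
  shows "dec a b (\<lambda>\<rho> fs F. (\<phi> \<rho> fs F :: nat) < \<psi> \<rho> fs F)"
  using dec_not[OF dec_le_nat[OF assms(2,1)]] by (simp add: not_le)

lemma dec_eq_nat:
  assumes "kcomp a b \<phi>" "kcomp a b \<psi>"
  shows "dec a b (\<lambda>\<rho> fs F. (\<phi> \<rho> fs F :: nat) = \<psi> \<rho> fs F)"
  using dec_conj[OF dec_le_nat[OF assms] dec_le_nat[OF assms(2,1)]] by (simp add: eq_iff)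

lemmas kcomp_intros = kcomp_const kcomp_var kcomp_Suc kcomp_add kcomp_mult kcomp_diff kcomp_power2
  kcomp_if kcomp_mu kcomp_oracle1 kcomp_oracle2
  dec_const dec_not dec_conj dec_disj dec_imp dec_ex dec_all dec_eq_nat dec_le_nat dec_less_nat

text \<open>Inverses of computable functions are obtained by searching for the preimage, here and
  for \<open>prod_decode\<close>, instead of by separate recursions.\<close>

lemma kcomp_div2:
  assumes "kcomp a b \<phi>" shows "kcomp a b (\<lambda>\<rho> fs F. \<phi> \<rho> fs F div 2)"
proof (rule kcomp_subst1[OF _ assms])
  have 1: "mu (\<lambda>m. 2 * m = n \<or> Suc (2 * m) = n) = n div 2" for n
    by (rule mu_eqI) presburger+
  have "kcomp (Suc a) b (\<lambda>\<rho> fs F. mu (\<lambda>m. 2 * m = \<rho> 0 \<or> Suc (2 * m) = \<rho> 0))"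
    by (intro kcomp_intros) simp_all
  then show "kcomp (Suc a) b (\<lambda>\<rho> fs F. \<rho> 0 div 2)" unfolding 1 .
qed

lemma dec_even:
  assumes "kcomp a b \<phi>" shows "dec a b (\<lambda>\<rho> fs F. even (\<phi> \<rho> fs F))"
proof -
  have "dec a b (\<lambda>\<rho> fs F. 2 * (\<phi> \<rho> fs F div 2) = \<phi> \<rho> fs F)"
    by (intro kcomp_intros kcomp_div2 assms)
  moreover have "2 * (n div 2) = n \<longleftrightarrow> even n" for n :: nat by presburger
  ultimately show ?thesis by simp
qed

lemma kcomp_prod_encode:
  assumes "kcomp a b \<phi>" "kcomp a b \<psi>"
  shows "kcomp a b (\<lambda>\<rho> fs F. prod_encode (\<phi> \<rho> fs F, \<psi> \<rho> fs F))"
  unfolding prod_encode_def triangle_def case_prod_conv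
  by (intro kcomp_intros kcomp_div2 assms)

lemma kcomp_fst_prod_decode:
  assumes "kcomp a b \<phi>" shows "kcomp a b (\<lambda>\<rho> fs F. fst (prod_decode (\<phi> \<rho> fs F)))"
proof (rule kcomp_subst1[OF _ assms])
  have 1: "mu (\<lambda>m. \<exists>k. prod_encode (m, k) = n) = fst (prod_decode n)" for n
    by (rule mu_eqI) (auto intro!: exI[of _ "snd (prod_decode n)"])
  have "kcomp (Suc a) b (\<lambda>\<rho> fs F. mu (\<lambda>m. \<exists>k. prod_encode (m, k) = \<rho> 0))"
    by (intro kcomp_intros kcomp_prod_encode) simp_all
  then show "kcomp (Suc a) b (\<lambda>\<rho> fs F. fst (prod_decode (\<rho> 0)))" unfolding 1 .
qed

lemma kcomp_snd_prod_decode: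
  assumes "kcomp a b \<phi>" shows "kcomp a b (\<lambda>\<rho> fs F. snd (prod_decode (\<phi> \<rho> fs F)))"
proof (rule kcomp_subst1[OF _ assms])
  have 1: "mu (\<lambda>m. \<exists>k. prod_encode (k, m) = n) = snd (prod_decode n)" for n
    by (rule mu_eqI) (auto intro!: exI[of _ "fst (prod_decode n)"])
  have "kcomp (Suc a) b (\<lambda>\<rho> fs F. mu (\<lambda>m. \<exists>k. prod_encode (k, m) = \<rho> 0))"
    by (intro kcomp_intros kcomp_prod_encode) simp_all
  then show "kcomp (Suc a) b (\<lambda>\<rho> fs F. snd (prod_decode (\<rho> 0)))" unfolding 1 .
qed

text \<open>Rationals are tracked as a difference of naturals over a positive natural, neither
  reduced nor coded: sums need no case distinction on signs, and the sign is found by comparing two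
  naturals.\<close>

definition qcomp :: "nat \<Rightarrow> nat \<Rightarrow>
    ((nat \<Rightarrow> nat) \<Rightarrow> (nat \<Rightarrow> nat) list \<Rightarrow> ((nat \<Rightarrow> nat) \<Rightarrow> nat) \<Rightarrow> real) \<Rightarrow> bool" where
  "qcomp a b \<phi> \<longleftrightarrow> (\<exists>p q d. kcomp a b p \<and> kcomp a b q \<and> kcomp a b d \<and>
    (\<forall>\<rho> fs F. d \<rho> fs F > 0 \<and>
      \<phi> \<rho> fs F = (real (p \<rho> fs F) - real (q \<rho> fs F)) / real (d \<rho> fs F)))"

lemma qcompI:
  assumes "kcomp a b p" "kcomp a b q" "kcomp a b d" "\<And>\<rho> fs F. d \<rho> fs F > 0"
    "\<And>\<rho> fs F. \<phi> \<rho> fs F = (real (p \<rho> fs F) - real (q \<rho> fs F)) / real (d \<rho> fs F)"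
  shows "qcomp a b \<phi>"
  using assms unfolding qcomp_def by blast

lemma qcompE:
  assumes "qcomp a b \<phi>"
  obtains p q d where "kcomp a b p" "kcomp a b q" "kcomp a b d" "\<forall>\<rho> fs F. d \<rho> fs F > 0"
    "\<phi> = (\<lambda>\<rho> fs F. (real (p \<rho> fs F) - real (q \<rho> fs F)) / real (d \<rho> fs F))"
proof -
  from assms obtain p q d where "kcomp a b p" "kcomp a b q" "kcomp a b d"
    and *: "\<forall>\<rho> fs F. d \<rho> fs F > 0 \<and>
      \<phi> \<rho> fs F = (real (p \<rho> fs F) - real (q \<rho> fs F)) / real (d \<rho> fs F)"
    unfolding qcomp_def by blast
  then show ?thesis by (intro that[of p q d]) (auto intro!: ext)
qed

lemma qcomp_of_nat:
  assumes "kcomp a b \<phi>" shows "qcomp a b (\<lambda>\<rho> fs F. real (\<phi> \<rho> fs F))"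
  by (rule qcompI[OF assms kcomp_const[of _ _ 0] kcomp_const[of _ _ 1]]) auto

lemma qcomp_uminus:
  assumes "qcomp a b \<phi>" shows "qcomp a b (\<lambda>\<rho> fs F. - \<phi> \<rho> fs F)"
proof -
  from assms obtain p q d where *: "kcomp a b p" "kcomp a b q" "kcomp a b d" "\<forall>\<rho> fs F. d \<rho> fs F > 0"
    and \<phi>: "\<phi> = (\<lambda>\<rho> fs F. (real (p \<rho> fs F) - real (q \<rho> fs F)) / real (d \<rho> fs F))" by (rule qcompE)
  show ?thesis by (rule qcompI[OF *(2,1,3) *(4)[rule_format]]) (simp add: \<phi> minus_divide_left)
qed

lemma qcomp_add:
  assumes "qcomp a b \<phi>" "qcomp a b \<psi>" shows "qcomp a b (\<lambda>\<rho> fs F. \<phi> \<rho> fs F + \<psi> \<rho> fs F)"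
proof -
  from assms(1) obtain p q d where *: "kcomp a b p" "kcomp a b q" "kcomp a b d" "\<forall>\<rho> fs F. d \<rho> fs F > 0"
    and \<phi>: "\<phi> = (\<lambda>\<rho> fs F. (real (p \<rho> fs F) - real (q \<rho> fs F)) / real (d \<rho> fs F))" by (rule qcompE)
  from assms(2) obtain p' q' d' where **: "kcomp a b p'" "kcomp a b q'" "kcomp a b d'" "\<forall>\<rho> fs F. d' \<rho> fs F > 0"
    and \<psi>: "\<psi> = (\<lambda>\<rho> fs F. (real (p' \<rho> fs F) - real (q' \<rho> fs F)) / real (d' \<rho> fs F))" by (rule qcompE)
  show ?thesis
  proof (rule qcompI)
    show "kcomp a b (\<lambda>\<rho> fs F. p \<rho> fs F * d' \<rho> fs F + p' \<rho> fs F * d \<rho> fs F)"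
      "kcomp a b (\<lambda>\<rho> fs F. q \<rho> fs F * d' \<rho> fs F + q' \<rho> fs F * d \<rho> fs F)"
      "kcomp a b (\<lambda>\<rho> fs F. d \<rho> fs F * d' \<rho> fs F)"
      by (intro kcomp_intros * **)+
    show "0 < d \<rho> fs F * d' \<rho> fs F" for \<rho> fs F
      using *(4)[rule_format, of \<rho> fs F] **(4)[rule_format, of \<rho> fs F] by simp
    show "\<phi> \<rho> fs F + \<psi> \<rho> fs F = (real (p \<rho> fs F * d' \<rho> fs F + p' \<rho> fs F * d \<rho> fs F) -
        real (q \<rho> fs F * d' \<rho> fs F + q' \<rho> fs F * d \<rho> fs F)) / real (d \<rho> fs F * d' \<rho> fs F)" for \<rho> fs F
      using *(4)[rule_format, of \<rho> fs F] **(4)[rule_format, of \<rho> fs F] by (simp add: \<phi> \<psi> field_simps)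
  qed
qed

lemma qcomp_diff:
  assumes "qcomp a b \<phi>" "qcomp a b \<psi>" shows "qcomp a b (\<lambda>\<rho> fs F. \<phi> \<rho> fs F - \<psi> \<rho> fs F)"
  using qcomp_add[OF assms(1) qcomp_uminus[OF assms(2)]] by simp

lemma dec_less_0:
  assumes "qcomp a b \<phi>" shows "dec a b (\<lambda>\<rho> fs F. \<phi> \<rho> fs F < 0)"
proof -
  from assms obtain p q d where *: "kcomp a b p" "kcomp a b q" "kcomp a b d" "\<forall>\<rho> fs F. d \<rho> fs F > 0"
    and \<phi>: "\<phi> = (\<lambda>\<rho> fs F. (real (p \<rho> fs F) - real (q \<rho> fs F)) / real (d \<rho> fs F))" by (rule qcompE)
  have "(\<phi> \<rho> fs F < 0) = (p \<rho> fs F < q \<rho> fs F)" for \<rho> fs F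
    using *(4)[rule_format, of \<rho> fs F] by (simp add: \<phi> divide_less_0_iff)
  with dec_less_nat[OF *(1,2)] show ?thesis by simp
qed

lemma dec_less:
  assumes "qcomp a b \<phi>" "qcomp a b \<psi>"
  shows "dec a b (\<lambda>\<rho> fs F. (\<phi> \<rho> fs F :: real) < \<psi> \<rho> fs F)"
  using dec_less_0[OF qcomp_diff[OF assms]] by simp

lemma dec_le:
  assumes "qcomp a b \<phi>" "qcomp a b \<psi>"
  shows "dec a b (\<lambda>\<rho> fs F. (\<phi> \<rho> fs F :: real) \<le> \<psi> \<rho> fs F)"
  using dec_not[OF dec_less[OF assms(2,1)]] by (simp add: not_less)

lemma qcomp_if:
  assumes "dec a b P" "qcomp a b \<phi>" "qcomp a b \<psi>"
  shows "qcomp a b (\<lambda>\<rho> fs F. if P \<rho> fs F then \<phi> \<rho> fs F else \<psi> \<rho> fs F)"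
proof -
  from assms(2) obtain p q d where *: "kcomp a b p" "kcomp a b q" "kcomp a b d" "\<forall>\<rho> fs F. d \<rho> fs F > 0"
    and \<phi>: "\<phi> = (\<lambda>\<rho> fs F. (real (p \<rho> fs F) - real (q \<rho> fs F)) / real (d \<rho> fs F))" by (rule qcompE)
  from assms(3) obtain p' q' d' where **: "kcomp a b p'" "kcomp a b q'" "kcomp a b d'" "\<forall>\<rho> fs F. d' \<rho> fs F > 0"
    and \<psi>: "\<psi> = (\<lambda>\<rho> fs F. (real (p' \<rho> fs F) - real (q' \<rho> fs F)) / real (d' \<rho> fs F))" by (rule qcompE)
  show ?thesis
    by (rule qcompI[OF kcomp_if[OF assms(1) *(1) **(1)] kcomp_if[OF assms(1) *(2) **(2)]
          kcomp_if[OF assms(1) *(3) **(3)]])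
       (auto simp: \<phi> \<psi> *(4) **(4))
qed

lemma qcomp_abs:
  assumes "qcomp a b \<phi>" shows "qcomp a b (\<lambda>\<rho> fs F. \<bar>\<phi> \<rho> fs F\<bar>)"
  unfolding abs_if by (intro qcomp_if dec_less_0 qcomp_uminus assms)

lemma qcomp_divide:
  assumes "qcomp a b \<phi>" "qcomp a b \<psi>" shows "qcomp a b (\<lambda>\<rho> fs F. \<phi> \<rho> fs F / \<psi> \<rho> fs F)"
proof -
  from assms(1) obtain p q d where *: "kcomp a b p" "kcomp a b q" "kcomp a b d" "\<forall>\<rho> fs F. d \<rho> fs F > 0"
    and \<phi>: "\<phi> = (\<lambda>\<rho> fs F. (real (p \<rho> fs F) - real (q \<rho> fs F)) / real (d \<rho> fs F))" by (rule qcompE)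
  from assms(2) obtain p' q' d' where **: "kcomp a b p'" "kcomp a b q'" "kcomp a b d'" "\<forall>\<rho> fs F. d' \<rho> fs F > 0"
    and \<psi>: "\<psi> = (\<lambda>\<rho> fs F. (real (p' \<rho> fs F) - real (q' \<rho> fs F)) / real (d' \<rho> fs F))" by (rule qcompE)
  \<comment> \<open>Swapping the two parts of the numerator absorbs the sign of the divisor. The sum
    of the two truncated differences in \<open>D\<close> is the absolute value of
    \<open>p' - q'\<close>.\<close>
  define A where "A = (\<lambda>\<rho> fs F. if q' \<rho> fs F \<le> p' \<rho> fs F then p \<rho> fs F else q \<rho> fs F)"
  define B where "B = (\<lambda>\<rho> fs F. if q' \<rho> fs F \<le> p' \<rho> fs F then q \<rho> fs F else p \<rho> fs F)"
  define D where "D = (\<lambda>\<rho> fs F. d \<rho> fs F * ((p' \<rho> fs F - q' \<rho> fs F) + (q' \<rho> fs F - p' \<rho> fs F)))"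
  have c: "kcomp a b A" "kcomp a b B" "kcomp a b D"
    unfolding A_def B_def D_def by (intro kcomp_intros * **)+
  \<comment> \<open>A vanishing divisor gives 0, as does a fraction with denominator 0 in
    \<open>nat_to_rat_surj\<close>.\<close>
  have "\<phi> \<rho> fs F / \<psi> \<rho> fs F = (if p' \<rho> fs F = q' \<rho> fs F then 0 else
    (real (A \<rho> fs F * d' \<rho> fs F) - real (B \<rho> fs F * d' \<rho> fs F)) / real (D \<rho> fs F))" for \<rho> fs F
    using *(4)[rule_format, of \<rho> fs F] **(4)[rule_format, of \<rho> fs F]
    by (cases "q' \<rho> fs F \<le> p' \<rho> fs F")
       (auto simp: \<phi> \<psi> A_def B_def D_def of_nat_diff divide_simps, auto simp: algebra_simps)
  moreover have "qcomp a b (\<lambda>\<rho> fs F. if p' \<rho> fs F = q' \<rho> fs F then 0 else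
    (real (A \<rho> fs F * d' \<rho> fs F) - real (B \<rho> fs F * d' \<rho> fs F)) / real (D \<rho> fs F))"
    by (rule qcompI[OF
          kcomp_if[OF dec_eq_nat[OF **(1,2)] kcomp_const[of _ _ 0] kcomp_mult[OF c(1) **(3)]]
          kcomp_if[OF dec_eq_nat[OF **(1,2)] kcomp_const[of _ _ 0] kcomp_mult[OF c(2) **(3)]]
          kcomp_if[OF dec_eq_nat[OF **(1,2)] kcomp_const[of _ _ 1] c(3)]])
       (use *(4) in \<open>auto simp: D_def\<close>)
  ultimately show ?thesis by simp
qed

lemma qcomp_power2:
  assumes "kcomp a b \<phi>" shows "qcomp a b (\<lambda>\<rho> fs F. 2 ^ \<phi> \<rho> fs F)"
  using qcomp_of_nat[OF kcomp_power2[OF assms]] by simp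

lemma qcomp_0: "qcomp a b (\<lambda>\<rho> fs F. 0)"
  and qcomp_1: "qcomp a b (\<lambda>\<rho> fs F. 1)"
  and qcomp_numeral: "qcomp a b (\<lambda>\<rho> fs F. numeral w)"
  using qcomp_of_nat[OF kcomp_const[of a b 0]] qcomp_of_nat[OF kcomp_const[of a b 1]]
    qcomp_of_nat[OF kcomp_const[of a b "numeral w"]] by simp_all

lemma qcomp_q_of:
  assumes "kcomp a b \<phi>" shows "qcomp a b (\<lambda>\<rho> fs F. q_of (\<phi> \<rho> fs F))"
proof -
  define I where "I n = (if even n then real (n div 2) else - real (Suc (n div 2)))" for n
  have I: "I n = of_int (int_decode n)" for n
    by (simp add: I_def int_decode_def sum_decode_def)
  have "q_of n = I (fst (prod_decode n)) / I (snd (prod_decode n))" for n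
    unfolding I nat_to_rat_surj_def by (simp add: of_rat_rat Fract_of_int_quotient of_rat_divide Let_def case_prod_beta)
  moreover have "qcomp a b (\<lambda>\<rho> fs F. I (fst (prod_decode (\<phi> \<rho> fs F))) / I (snd (prod_decode (\<phi> \<rho> fs F))))"
    unfolding I_def
    by (intro qcomp_divide qcomp_if dec_even qcomp_uminus qcomp_of_nat kcomp_intros kcomp_div2
        kcomp_fst_prod_decode kcomp_snd_prod_decode assms)
  ultimately show ?thesis by simp
qed

lemmas qcomp_intros = qcomp_0 qcomp_1 qcomp_numeral qcomp_q_of qcomp_power2 qcomp_divide qcomp_add
  qcomp_diff qcomp_abs dec_less dec_le kcomp_fst_prod_decode kcomp_snd_prod_decode kcomp_intros

section \<open>Oscillation of quasi-continuous functions\<close>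

lemma ex_q_of_between:
  assumes "x < y" obtains a where "x < q_of a" "q_of a < y"
  using of_rat_dense[OF assms] surj_nat_to_rat_surj by (metis surjD)

lemma ex_q_of_eq: obtains a where "q_of a = of_rat r"
  using surj_nat_to_rat_surj by (metis surjD)

lemma ex_inverse_power2_less:
  assumes "0 < (e :: real)" obtains n where "1 / 2 ^ n < e"
  using real_arch_pow_inv[OF assms, of "1/2"] by (auto simp: power_one_over)

lemma ex_q_of_in_open:
  assumes "open U" "x \<in> U" "x \<in> {0..1::real}"
  obtains a where "q_of a \<in> U" "q_of a \<in> {0..1}"
proof -
  obtain d where d: "d > 0" "ball x d \<subseteq> U" using assms(1,2) open_contains_ball by blast
  have "max 0 (x - d) < min 1 (x + d)" using d assms(3) by auto
  then obtain a where "max 0 (x - d) < q_of a" "q_of a < min 1 (x + d)" by (rule ex_q_of_between)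
  then show ?thesis using d by (intro that[of a]) (auto simp: dist_real_def subset_iff)
qed

lemma names_real_approx:
  assumes "names_real \<alpha> x" shows "\<bar>q_of (\<alpha> n) - x\<bar> \<le> 1 / 2 ^ n"
proof -
  have "(\<lambda>i. q_of (\<alpha> (i + n))) \<longlonglongrightarrow> x"
    using assms LIMSEQ_ignore_initial_segment unfolding names_real_def by blast
  then have "(\<lambda>i. \<bar>q_of (\<alpha> n) - q_of (\<alpha> (i + n))\<bar>) \<longlonglongrightarrow> \<bar>q_of (\<alpha> n) - x\<bar>"
    by (intro tendsto_intros)
  moreover have "\<bar>q_of (\<alpha> n) - q_of (\<alpha> (i + n))\<bar> \<le> 1 / 2 ^ n" for i
    using assms unfolding names_real_def by (metis add.commute less_imp_le)
  ultimately show ?thesis by (intro LIMSEQ_le_const2) auto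
qed

lemma names_real_const: "names_real (\<lambda>_. a) (q_of a)"
  by (simp add: names_real_def)

text \<open>Terms \<open>n\<close> and \<open>n + i\<close> then differ by at most 2^-(n+1), so the
  exponent \<open>n + 2\<close> leaves room for the strict inequality in
  \<open>names_real\<close>.\<close>

lemma names_realI:
  assumes "\<And>n. \<bar>q_of (\<alpha> n) - x\<bar> \<le> 1 / 2 ^ (n + 2)"
  shows "names_real \<alpha> x"
  unfolding names_real_def
proof (intro conjI allI)
  fix n i
  have "(1::real) / 2 ^ (n + i + 2) \<le> 1 / 2 ^ (n + 2)" by (simp add: field_simps)
  then have "\<bar>q_of (\<alpha> n) - q_of (\<alpha> (n + i))\<bar> \<le> 2 * (1 / 2 ^ (n + 2))"
    using assms[of n] assms[of "n + i"] by linarith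
  also have "\<dots> < 1 / 2 ^ n" by (simp add: field_simps)
  finally show "\<bar>q_of (\<alpha> n) - q_of (\<alpha> (n + i))\<bar> < 1 / 2 ^ n" .
next
  have "(\<lambda>n. q_of (\<alpha> n) - x) \<longlonglongrightarrow> 0"
  proof (rule Lim_null_comparison)
    show "\<forall>\<^sub>F n in sequentially. norm (q_of (\<alpha> n) - x) \<le> (1 / 2) ^ n"
      using assms by (intro always_eventually allI order_trans[OF assms[folded real_norm_def]])
        (simp add: power_one_over field_simps)
    show "(\<lambda>n. (1 / 2 :: real) ^ n) \<longlonglongrightarrow> 0" by (rule LIMSEQ_power_zero) simp
  qed
  then show "(\<lambda>n. q_of (\<alpha> n)) \<longlonglongrightarrow> x" by (simp add: LIM_zero_iff)
qed

text \<open>Turns a strict inequality for a limit into a search over its approximations. The factor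
  \<open>c\<close> is 1 for a single name and 2 for a difference of two.\<close>

lemma less_limit_iff:
  assumes "\<And>n. \<bar>u n - x\<bar> \<le> c / 2 ^ n"
  shows "r < x \<longleftrightarrow> (\<exists>n. r + c / 2 ^ n < (u n :: real))"
proof
  assume "r < x"
  have c: "0 \<le> c" using assms[of 0] by simp
  \<comment> \<open>The error \<open>c / 2 ^ n\<close> is spent twice, in \<open>u n\<close> and in
    the test, hence \<open>2 * c\<close>; adding 1 avoids a zero divisor if
    \<open>c = 0\<close>.\<close>
  obtain n where n: "1 / 2 ^ n < (x - r) / (2 * c + 1)"
    using \<open>r < x\<close> c by (auto intro: ex_inverse_power2_less[of "(x - r) / (2 * c + 1)"])
  have "2 * (c / 2 ^ n) \<le> (2 * c + 1) * (1 / 2 ^ n)" by (simp add: field_simps)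
  also have "\<dots> < x - r" using n c by (simp add: field_simps)
  finally have "r + c / 2 ^ n < u n" using assms[of n] by linarith
  then show "\<exists>n. r + c / 2 ^ n < u n" ..
next
  assume "\<exists>n. r + c / 2 ^ n < u n"
  then obtain n where "r + c / 2 ^ n < u n" ..
  then show "r < x" using assms[of n] by linarith
qed

text \<open>The nonempty open set that quasi-continuity provides contains a rational, around which a
  ball fits. The point \<open>x\<close> itself need not lie in that ball.\<close>

lemma quasi_continuous_ball:
  assumes "quasi_continuous f" "x \<in> {0..1}" "open U" "x \<in> U" "e > 0"
  obtains a r where "r > 0" "q_of a \<in> {0..1}" "ball (q_of a) r \<inter> {0..1} \<subseteq> U"
    "\<forall>y\<in>ball (q_of a) r \<inter> {0..1}. \<bar>f x - f y\<bar> < e"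
proof -
  have "openin (top_of_set {0..1}) ({0..1} \<inter> U)" "x \<in> {0..1} \<inter> U"
    using assms by (auto intro: openin_open_Int)
  then obtain G where G: "openin (top_of_set {0..1}) G" "G \<noteq> {}" "G \<subseteq> {0..1} \<inter> U"
    "\<And>y. y \<in> G \<Longrightarrow> \<bar>f x - f y\<bar> < e"
    using assms unfolding quasi_continuous_def quasi_continuous_at_def by meson
  then obtain T where T: "open T" "G = {0..1} \<inter> T" unfolding openin_open by blast
  with G(2) obtain c where "c \<in> T" "c \<in> {0..1}" by blast
  from ex_q_of_in_open[OF T(1) this] obtain a where a: "q_of a \<in> T" "q_of a \<in> {0..1}" .
  obtain r where "r > 0" "ball (q_of a) r \<subseteq> T" using T(1) a(1) open_contains_ball by blast
  then show ?thesis using a(2) G(3,4) T(2) by (intro that[of r a]) blast+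
qed

lemma quasi_continuous_q_of:
  assumes "quasi_continuous f" "x \<in> {0..1}" "open U" "x \<in> U" "e > 0"
  obtains a where "q_of a \<in> U" "q_of a \<in> {0..1}" "\<bar>f x - f (q_of a)\<bar> < e"
proof -
  from assms obtain a r where "r > 0" "q_of a \<in> {0..1}" "ball (q_of a) r \<inter> {0..1} \<subseteq> U"
    "\<forall>y\<in>ball (q_of a) r \<inter> {0..1}. \<bar>f x - f y\<bar> < e" by (rule quasi_continuous_ball)
  moreover from this have "q_of a \<in> ball (q_of a) r \<inter> {0..1}" by simp
  ultimately show ?thesis by (intro that[of a]) blast+
qed

text \<open>Quasi-continuity gives no information inside \<open>[p,q]\<close> at the end points, but these are
  rational themselves.\<close>

lemma less_SUP_iff_q_of:
  assumes "quasi_continuous f" "0 \<le> q_of p" "q_of q \<le> 1"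
  shows "ereal t < (SUP x\<in>{q_of p..q_of q}. ereal (f x)) \<longleftrightarrow>
    (\<exists>b. q_of p \<le> q_of b \<and> q_of b \<le> q_of q \<and> t < f (q_of b))"
proof
  assume "ereal t < (SUP x\<in>{q_of p..q_of q}. ereal (f x))"
  then obtain x where x: "q_of p \<le> x" "x \<le> q_of q" "t < f x" by (auto simp: less_SUP_iff)
  consider "x = q_of p" | "x = q_of q" | "x \<in> {q_of p<..<q_of q}" using x by force
  then show "\<exists>b. q_of p \<le> q_of b \<and> q_of b \<le> q_of q \<and> t < f (q_of b)"
  proof cases
    case 3
    have "x \<in> {0..1}" using x assms(2,3) unfolding atLeastAtMost_iff by linarith
    then obtain b where "q_of b \<in> {q_of p<..<q_of q}" "\<bar>f x - f (q_of b)\<bar> < f x - t"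
      by (rule quasi_continuous_q_of[OF assms(1) _ _ 3, of "f x - t"]) (use x in auto)
    then show ?thesis by (intro exI[of _ b]) auto
  qed (use x in auto)
next
  assume "\<exists>b. q_of p \<le> q_of b \<and> q_of b \<le> q_of q \<and> t < f (q_of b)"
  then show "ereal t < (SUP x\<in>{q_of p..q_of q}. ereal (f x))" by (force simp: less_SUP_iff)
qed

text \<open>For \<open>U\<close> meeting [0,1] this says that the oscillation over \<open>U\<close>
  exceeds \<open>t\<close> (see \<open>less_osc_on_iff\<close>), but without suprema or infinite
  values.\<close>

definition varies :: "(real \<Rightarrow> real) \<Rightarrow> real set \<Rightarrow> real \<Rightarrow> bool" where
  "varies f U t \<longleftrightarrow> (\<exists>y\<in>U \<inter> {0..1}. \<exists>z\<in>U \<inter> {0..1}. t < f y - f z)"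

lemma varies_iff_q_of:
  assumes "quasi_continuous f" "open U"
  shows "varies f U t \<longleftrightarrow>
    (\<exists>b c. q_of b \<in> U \<inter> {0..1} \<and> q_of c \<in> U \<inter> {0..1} \<and> t < f (q_of b) - f (q_of c))"
proof
  assume "varies f U t"
  then obtain y z where yz: "y \<in> U" "y \<in> {0..1}" "z \<in> U" "z \<in> {0..1}" "t < f y - f z"
    unfolding varies_def by blast
  \<comment> \<open>Half of the excess over \<open>t\<close> may be lost at each of the two
    points.\<close>
  define e where "e = (f y - f z - t) / 2"
  have e: "e > 0" using yz by (simp add: e_def)
  obtain b where b: "q_of b \<in> U" "q_of b \<in> {0..1}" "\<bar>f y - f (q_of b)\<bar> < e"
    by (rule quasi_continuous_q_of[OF assms(1) yz(2) assms(2) yz(1) e])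
  obtain c where c: "q_of c \<in> U" "q_of c \<in> {0..1}" "\<bar>f z - f (q_of c)\<bar> < e"
    by (rule quasi_continuous_q_of[OF assms(1) yz(4) assms(2) yz(3) e])
  have "t < f (q_of b) - f (q_of c)" 
  proof -
    have "2 * e = f y - f z - t" by (simp add: e_def)
    then show ?thesis using b(3) c(3) unfolding abs_less_iff by linarith
  qed
  then show "\<exists>b c. q_of b \<in> U \<inter> {0..1} \<and> q_of c \<in> U \<inter> {0..1} \<and> t < f (q_of b) - f (q_of c)"
    using b c by blast
next
  assume "\<exists>b c. q_of b \<in> U \<inter> {0..1} \<and> q_of c \<in> U \<inter> {0..1} \<and> t < f (q_of b) - f (q_of c)"
  then show "varies f U t" unfolding varies_def by blast
qed

lemma less_osc_on_iff:
  assumes "U \<inter> {0..1} \<noteq> {}"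
  shows "ereal t < osc_on f (U \<inter> {0..1}) \<longleftrightarrow> varies f U t"
proof
  define S where "S = U \<inter> {0..1}"
  define s i where "s = (SUP x\<in>S. ereal (f x))" and "i = (INF x\<in>S. ereal (f x))"
  have osc: "osc_on f S = s - i" by (simp add: osc_on_def s_def i_def)
  have si: "ereal (f y) \<le> s" "i \<le> ereal (f y)" if "y \<in> S" for y
    using that by (auto simp: s_def i_def intro: SUP_upper INF_lower)
  {
    assume less: "ereal t < osc_on f (U \<inter> {0..1})"
    show "varies f U t"
    proof (rule ccontr)
      assume "\<not> varies f U t"
      then have le: "f y \<le> f z + t" if "y \<in> S" "z \<in> S" for y z
        using that unfolding varies_def S_def by force
      have s: "s \<le> ereal (f z + t)" if "z \<in> S" for z
        unfolding s_def by (rule SUP_least) (use le that in auto)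
      obtain z where z: "z \<in> S" using assms S_def by blast
      \<comment> \<open>A bound on all differences bounds \<open>f\<close> on \<open>S\<close>, so
        \<open>s\<close> is finite and the subtraction in \<open>ereal\<close> is an ordinary
        one.\<close>
      obtain s' where s': "s = ereal s'" using s[OF z] si(1)[OF z] by (cases s) auto
      have "ereal (s' - t) \<le> i"
        unfolding i_def by (rule INF_greatest) (use s s' in force)
      then have "s - i \<le> ereal t" using si(2)[OF z] by (cases i) (auto simp: s')
      then show False using less osc S_def by simp
    qed
  next
    assume "varies f U t"
    then obtain y z where yz: "y \<in> S" "z \<in> S" "t < f y - f z" unfolding varies_def S_def by blast
    then have "ereal t < ereal (f y) - ereal (f z)" by simp
    also have "\<dots> \<le> s - i" using si yz by (intro ereal_minus_mono) auto
    finally show "ereal t < osc_on f (U \<inter> {0..1})" using osc S_def by simp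
  }
qed

text \<open>The oscillation decreases as the balls shrink, so the limit exists in the extended
  reals.\<close>

lemma osc_eq_INF: "osc f x = (INF k. osc_on f (ball x (1 / 2 ^ k) \<inter> {0..1}))"
  unfolding osc_def
proof (rule limI, rule LIMSEQ_INF, rule decseq_SucI)
  fix k
  have "ball x (1 / 2 ^ Suc k) \<inter> {0..1} \<subseteq> ball x (1 / 2 ^ k) \<inter> {0..1}"
    by (intro Int_mono subset_ball) (auto simp: field_simps)
  then show "osc_on f (ball x (1 / 2 ^ Suc k) \<inter> {0..1}) \<le> osc_on f (ball x (1 / 2 ^ k) \<inter> {0..1})"
    unfolding osc_on_def by (intro ereal_minus_mono SUP_subset_mono INF_superset_mono) auto
qed

text \<open>Exceeding \<open>t\<close> on every ball would only make the infimum at least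
  \<open>t\<close>. A rational strictly above \<open>t\<close> restores strictness.\<close>

lemma less_osc_iff:
  assumes "x \<in> {0..1}"
  shows "ereal t < osc f x \<longleftrightarrow> (\<exists>a. t < q_of a \<and> (\<forall>k. varies f (ball x (1 / 2 ^ k)) (q_of a)))"
proof -
  have ne: "ball x (1 / 2 ^ k) \<inter> {0..1} \<noteq> {}" for k
  proof -
    have "x \<in> ball x (1 / 2 ^ k) \<inter> {0..1}" using assms by simp
    then show ?thesis by blast
  qed
  have *: "varies f (ball x (1 / 2 ^ k)) u \<longleftrightarrow> ereal u < osc_on f (ball x (1 / 2 ^ k) \<inter> {0..1})" for u k
    using less_osc_on_iff[OF ne] by simp
  show ?thesis
  proof
    assume "ereal t < osc f x"
    then obtain u where u: "t < u" "ereal u < osc f x" using ereal_dense2 by force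
    obtain a where a: "t < q_of a" "q_of a < u" using ex_q_of_between[OF u(1)] .
    have "ereal (q_of a) < osc_on f (ball x (1 / 2 ^ k) \<inter> {0..1})" for k
    proof -
      have "ereal (q_of a) < ereal u" using a by simp
      also note u(2)
      also have "osc f x \<le> osc_on f (ball x (1 / 2 ^ k) \<inter> {0..1})"
        unfolding osc_eq_INF by (rule INF_lower) simp
      finally show ?thesis .
    qed
    then show "\<exists>a. t < q_of a \<and> (\<forall>k. varies f (ball x (1 / 2 ^ k)) (q_of a))" using * a by blast
  next
    assume "\<exists>a. t < q_of a \<and> (\<forall>k. varies f (ball x (1 / 2 ^ k)) (q_of a))"
    then obtain a where a: "t < q_of a" "\<And>k. varies f (ball x (1 / 2 ^ k)) (q_of a)" by blast
    have "ereal t < ereal (q_of a)" using a by simp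
    also have "\<dots> \<le> osc f x"
      unfolding osc_eq_INF by (rule INF_greatest) (use a(2) * in \<open>auto intro: less_imp_le\<close>)
    finally show "ereal t < osc f x" .
  qed
qed

text \<open>This Cauchy form of continuity does not single out the value \<open>f x\<close>, so for
  quasi-continuous \<open>f\<close> it can be tested at rational points by
  \<open>varies_iff_q_of\<close>.\<close>

lemma cont_points_iff_varies:
  "x \<in> cont_points f \<longleftrightarrow>
    x \<in> {0..1} \<and> (\<forall>e>0. \<exists>d>0. \<not> varies f (ball x d) e)"
proof (cases "x \<in> {0..1}")
  case True
  have "continuous (at x within {0..1}) f \<longleftrightarrow> (\<forall>e>0. \<exists>d>0. \<not> varies f (ball x d) e)"
  proof
    assume cont: "continuous (at x within {0..1}) f"
    show "\<forall>e>0. \<exists>d>0. \<not> varies f (ball x d) e"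
    proof (intro allI impI)
      fix e :: real assume "e > 0"
      then obtain d where d: "d > 0" "\<And>y. y \<in> {0..1} \<Longrightarrow> dist y x < d \<Longrightarrow> dist (f y) (f x) < e / 2"
        using cont unfolding continuous_within_eps_delta by (meson half_gt_zero)
      have "\<not> varies f (ball x d) e"
      proof
        assume "varies f (ball x d) e"
        then obtain y z where "dist y x < d" "y \<in> {0..1}" "dist z x < d" "z \<in> {0..1}" "e < f y - f z"
          unfolding varies_def by (metis IntE dist_commute mem_ball)
        then show False using d(2)[of y] d(2)[of z] unfolding dist_real_def by linarith
      qed
      then show "\<exists>d>0. \<not> varies f (ball x d) e" using d(1) by blast
    qed
  next
    assume *: "\<forall>e>0. \<exists>d>0. \<not> varies f (ball x d) e"
    show "continuous (at x within {0..1}) f"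
      unfolding continuous_within_eps_delta
    proof (intro allI impI)
      fix e :: real assume "e > 0"
      then obtain d where d: "d > 0" "\<not> varies f (ball x d) (e / 2)" using * half_gt_zero by blast
      have "dist (f y) (f x) < e" if "y \<in> {0..1}" "dist y x < d" for y
      proof -
        have "x \<in> ball x d \<inter> {0..1}" "y \<in> ball x d \<inter> {0..1}"
          using d that True by (auto simp: dist_commute)
        then have "f y - f x \<le> e / 2" "f x - f y \<le> e / 2"
          using d(2) unfolding varies_def by (meson not_le)+
        then show ?thesis using \<open>e > 0\<close> unfolding dist_real_def by linarith
      qed
      then show "\<exists>d>0. \<forall>y\<in>{0..1}. dist y x < d \<longrightarrow> dist (f y) (f x) < e" using d(1) by blast
    qed
  qed
  then show ?thesis using True by (simp add: cont_points_def)
qed (auto simp: cont_points_def)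

lemma varies_mono: "varies f U t \<Longrightarrow> U \<inter> {0..1} \<subseteq> V \<Longrightarrow> s \<le> t \<Longrightarrow> varies f V s"
proof -
  assume "varies f U t" and sub: "U \<inter> {0..1} \<subseteq> V" "s \<le> t"
  then obtain y z where yz: "y \<in> U \<inter> {0..1}" "z \<in> U \<inter> {0..1}" "t < f y - f z"
    unfolding varies_def by blast
  then have "y \<in> V \<inter> {0..1}" "z \<in> V \<inter> {0..1}" "s < f y - f z" using sub by auto
  then show "varies f V s" unfolding varies_def by blast
qed

lemma cont_points_iff_osc:
  assumes "x \<in> {0..1}"
  shows "x \<in> cont_points f \<longleftrightarrow> \<not> 0 < osc f x"
proof -
  have "0 < osc f x \<longleftrightarrow> \<not> (\<forall>e>0. \<exists>d>0. \<not> varies f (ball x d) e)"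
    unfolding zero_ereal_def less_osc_iff[OF assms]
  proof
    assume "\<exists>a. 0 < q_of a \<and> (\<forall>k. varies f (ball x (1 / 2 ^ k)) (q_of a))"
    then obtain a where a: "0 < q_of a" "\<And>k. varies f (ball x (1 / 2 ^ k)) (q_of a)" by blast
    have "varies f (ball x d) (q_of a)" if d: "d > 0" for d
    proof -
      obtain k where "1 / 2 ^ k < d" using ex_inverse_power2_less[OF d] .
      then show ?thesis using a(2)[of k] by (elim varies_mono) auto
    qed
    then show "\<not> (\<forall>e>0. \<exists>d>0. \<not> varies f (ball x d) e)" using a(1) by blast
  next
    assume "\<not> (\<forall>e>0. \<exists>d>0. \<not> varies f (ball x d) e)"
    then obtain e where e: "e > 0" "\<And>d. d > 0 \<Longrightarrow> varies f (ball x d) e" by blast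
    obtain a where a: "0 < q_of a" "q_of a < e" using ex_q_of_between[OF e(1)] .
    have "varies f (ball x (1 / 2 ^ k)) (q_of a)" for k
      by (rule varies_mono[OF e(2)[of "1 / 2 ^ k"]]) (use a(2) in auto)
    then show "\<exists>a. 0 < q_of a \<and> (\<forall>k. varies f (ball x (1 / 2 ^ k)) (q_of a))" using a(1) by blast
  qed
  then show ?thesis using assms cont_points_iff_varies by blast
qed

section \<open>Codes of balls, tame balls and the set of continuity points\<close>

definition centre :: "nat \<Rightarrow> real" where "centre m = q_of (fst (prod_decode m))"
definition radius :: "nat \<Rightarrow> real" where "radius m = q_of (snd (prod_decode m))"

lemma ex_ball_code:
  obtains m where "centre m = q_of a" "radius m = q_of r"
  by (rule that[of "prod_encode (a, r)"]) (simp_all add: centre_def radius_def)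

lemma RM_open_set_eq: "RM_open_set c = (\<Union>m. ball (centre (c m)) (radius (c m)))"
  by (simp add: RM_open_set_def centre_def radius_def case_prod_beta)

lemma q_of_0: "q_of 0 = 0"
proof -
  have "prod_decode 0 = (0, 0)" by (simp add: prod_decode_def prod_decode_aux.simps)
  moreover have "int_decode 0 = 0" by (simp add: int_decode_def sum_decode_def)
  ultimately show ?thesis by (simp add: nat_to_rat_surj_def rat_number_collapse)
qed

text \<open>Makes code 0 denote the empty ball, the filler for codes that are not tame.\<close>

lemma radius_0: "radius 0 = 0"
proof -
  have "prod_decode 0 = (0, 0)" by (simp add: prod_decode_def prod_decode_aux.simps)
  then show ?thesis using q_of_0 by (simp add: radius_def)
qed

text \<open>Centres in \<open>[0,1]\<close> and small radii keep the intersection of the open sets inside \<open>[0,1]\<close>.\<close>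

definition tame :: "(real \<Rightarrow> real) \<Rightarrow> nat \<Rightarrow> nat \<Rightarrow> bool" where
  "tame f n m \<longleftrightarrow> centre m \<in> {0..1} \<and> radius m < 1 / 2 ^ n \<and>
    \<not> varies f (ball (centre m) (radius m)) (1 / 2 ^ n)"

text \<open>A code of an open set is a total sequence, so place \<open>m\<close> lists
  \<open>m\<close> itself if it is tame and the empty ball otherwise.\<close>

lemma cont_points_eq_INT:
  "cont_points f = (\<Inter>n. RM_open_set (\<lambda>m. if tame f n m then m else 0))"
proof -
  have "RM_open_set (\<lambda>m. if tame f n m then m else 0) = (\<Union>m\<in>{m. tame f n m}. ball (centre m) (radius m))" for n
    unfolding RM_open_set_eq by (auto simp: radius_0 split: if_splits)
  moreover have "x \<in> cont_points f \<longleftrightarrow> (\<forall>n. \<exists>m. tame f n m \<and> x \<in> ball (centre m) (radius m))" for x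
  proof
    assume x: "x \<in> cont_points f"
    show "\<forall>n. \<exists>m. tame f n m \<and> x \<in> ball (centre m) (radius m)"
    proof
      fix n
      have x01: "x \<in> {0..1}" using x cont_points_iff_varies by blast
      have "(0::real) < 1 / 2 ^ n" by simp
      then obtain d where d: "d > 0" "\<not> varies f (ball x d) (1 / 2 ^ n)"
        using x cont_points_iff_varies by meson
      \<comment> \<open>A centre at distance below \<open>h\<close> from \<open>x\<close> and a
        radius below \<open>h\<close> keep the ball within \<open>2 * h\<close> of \<open>x\<close>,
        hence inside \<open>ball x d\<close>; the radius also meets the bound in
        \<open>tame\<close>.\<close>
      define h where "h = min d (1 / 2 ^ n) / 2"
      have h: "h > 0" "2 * h \<le> d" "2 * h \<le> 1 / 2 ^ n" using d by (auto simp: h_def)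
      have "x \<in> ball x h" using h by simp
      from ex_q_of_in_open[OF open_ball this x01]
      obtain a where a: "q_of a \<in> ball x h" "q_of a \<in> {0..1}" .
      then have "dist x (q_of a) < h" by simp
      then obtain r where r: "dist x (q_of a) < q_of r" "q_of r < h" using ex_q_of_between by blast
      obtain m where m: "centre m = q_of a" "radius m = q_of r" by (rule ex_ball_code)
      have "ball (q_of a) (q_of r) \<subseteq> ball x d"
      proof
        fix y assume "y \<in> ball (q_of a) (q_of r)"
        then have "dist x y < h + h" using a r dist_triangle[of x y "q_of a"] by auto
        then show "y \<in> ball x d" using h by simp
      qed
      then have "\<not> varies f (ball (q_of a) (q_of r)) (1 / 2 ^ n)"
        using d(2) varies_mono by blast
      then have "tame f n m" using h r a unfolding tame_def m by auto
      moreover have "x \<in> ball (centre m) (radius m)" using r m by (simp add: dist_commute)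
      ultimately show "\<exists>m. tame f n m \<and> x \<in> ball (centre m) (radius m)" by blast
    qed
  next
    assume *: "\<forall>n. \<exists>m. tame f n m \<and> x \<in> ball (centre m) (radius m)"
    \<comment> \<open>For every \<open>n\<close>, \<open>x\<close> is within 2^-n of a centre in
      [0,1], which forces \<open>x\<close> into the closed interval.\<close>
    have bnd: "- (1 / 2 ^ n) < x \<and> x < 1 + 1 / 2 ^ n" for n
      using *[rule_format, of n] unfolding tame_def by (auto simp: dist_real_def)
    have "x \<in> {0..1}"
    proof (rule ccontr)
      assume "x \<notin> {0..1}"
      then have "0 < max (- x) (x - 1)" by auto
      then obtain n where "1 / 2 ^ n < max (- x) (x - 1)" by (rule ex_inverse_power2_less)
      then show False using bnd[of n] by linarith
    qed
    moreover have "\<exists>d>0. \<not> varies f (ball x d) e" if e: "e > 0" for e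
    proof -
      obtain n where n: "1 / 2 ^ n < e" using ex_inverse_power2_less[OF e] .
      obtain m where m: "tame f n m" "x \<in> ball (centre m) (radius m)" using * by blast
      then obtain d where d: "d > 0" "ball x d \<subseteq> ball (centre m) (radius m)"
        using open_contains_ball[of "ball (centre m) (radius m)"] open_ball by blast
      have "\<not> varies f (ball x d) e"
        using m(1) varies_mono[of f "ball x d" e "ball (centre m) (radius m)" "1 / 2 ^ n"] d n
        unfolding tame_def by auto
      then show ?thesis using d(1) by blast
    qed
    ultimately show "x \<in> cont_points f" using cont_points_iff_varies by blast
  qed
  ultimately show ?thesis by auto
qed

text \<open>The inequality puts even the closed ball of \<open>m'\<close> inside the open ball of
  \<open>m\<close>, so a limit of centres cannot escape to the boundary.\<close>

definition tame_subball :: "(real \<Rightarrow> real) \<Rightarrow> nat \<Rightarrow> nat \<Rightarrow> nat \<Rightarrow> bool" where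
  "tame_subball f n m m' \<longleftrightarrow> tame f n m' \<and> 0 < radius m' \<and>
    \<bar>centre m' - centre m\<bar> + radius m' < radius m"

text \<open>Quasi-continuity is applied at \<open>centre m\<close>, which must therefore lie in
  [0,1]. Since \<open>tame\<close> demands the same of the new centre, the step can be
  iterated.\<close>

lemma ex_tame_subball:
  assumes "quasi_continuous f" "centre m \<in> {0..1}" "0 < radius m"
  shows "\<exists>m'. tame_subball f n m m'"
proof -
  \<comment> \<open>Two values within \<open>h\<close> of \<open>f (centre m)\<close> differ by less
    than 2^-n.\<close>
  define h :: real where "h = 1 / 2 ^ n / 2"
  have h: "0 < h" "2 * h = 1 / 2 ^ n" by (auto simp: h_def)
  obtain a d where d: "d > 0" and a: "q_of a \<in> {0..1}"
    and sub: "ball (q_of a) d \<inter> {0..1} \<subseteq> ball (centre m) (radius m)"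
    and near: "\<forall>y\<in>ball (q_of a) d \<inter> {0..1}. \<bar>f (centre m) - f y\<bar> < h"
    by (rule quasi_continuous_ball[OF assms(1,2) open_ball, of "centre m" "radius m" h])
       (use assms h in auto)
  have "q_of a \<in> ball (centre m) (radius m)" using sub d a centre_in_ball by blast
  then have "0 < Min {d, 1 / 2 ^ n, radius m - \<bar>q_of a - centre m\<bar>}"
    using d by (auto simp: dist_real_def)
  then obtain r where r: "0 < q_of r" "q_of r < Min {d, 1 / 2 ^ n, radius m - \<bar>q_of a - centre m\<bar>}"
    by (rule ex_q_of_between)
  obtain m' where m': "centre m' = q_of a" "radius m' = q_of r" by (rule ex_ball_code)
  have "\<not> varies f (ball (q_of a) (q_of r)) (1 / 2 ^ n)"
  proof
    assume "varies f (ball (q_of a) (q_of r)) (1 / 2 ^ n)"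
    then have "varies f (ball (q_of a) d) (1 / 2 ^ n)" using r by (elim varies_mono) auto
    then obtain y z where yz: "y \<in> ball (q_of a) d \<inter> {0..1}" "z \<in> ball (q_of a) d \<inter> {0..1}"
      "1 / 2 ^ n < f y - f z" unfolding varies_def by blast
    then show False using near[rule_format, OF yz(1)] near[rule_format, OF yz(2)] h(2) by linarith
  qed
  then have "tame_subball f n m m'" using a r unfolding tame_subball_def tame_def m' by auto
  then show ?thesis ..
qed

text \<open>The ball \<open>m (Suc n)\<close> is tame at level \<open>n\<close>, so its radius is
  below 2^-n and the centres from index 1 on form a name without passing to a subsequence. The
  initial ball \<open>m 0\<close> carries no such bound.\<close>

lemma nested_balls_converge:
  assumes m: "\<And>n. tame_subball f n (m n) (m (Suc n))"
  obtains x where "x \<in> cont_points f" "names_real (\<lambda>n. fst (prod_decode (m (Suc n)))) x"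
proof -
  have sub: "ball (centre (m (Suc n))) (radius (m (Suc n))) \<subseteq> ball (centre (m n)) (radius (m n))" for n
  proof
    fix y assume "y \<in> ball (centre (m (Suc n))) (radius (m (Suc n)))"
    then show "y \<in> ball (centre (m n)) (radius (m n))"
      using m[of n] unfolding tame_subball_def by (auto simp: dist_real_def)
  qed
  have inner: "centre (m (Suc (n + i))) \<in> ball (centre (m (Suc n))) (radius (m (Suc n)))" for n i
  proof -
    have "ball (centre (m (Suc (n + i)))) (radius (m (Suc (n + i)))) \<subseteq>
        ball (centre (m (Suc n))) (radius (m (Suc n)))"
      using lift_Suc_antimono_le[of "\<lambda>n. ball (centre (m n)) (radius (m n))" "Suc n" "Suc (n + i)"] sub
      by auto
    moreover have "0 < radius (m (Suc (n + i)))" using m[of "n + i"] unfolding tame_subball_def by blast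
    ultimately show ?thesis using centre_in_ball by blast
  qed
  have r: "radius (m (Suc n)) < 1 / 2 ^ n" for n using m[of n] unfolding tame_subball_def tame_def by blast
  have close: "\<bar>centre (m (Suc n)) - centre (m (Suc (n + i)))\<bar> < 1 / 2 ^ n" for n i
    using inner[of n i] r[of n] by (simp add: dist_real_def)
  have "Cauchy (\<lambda>n. centre (m (Suc n)))"
  proof (rule CauchyI')
    fix e :: real assume "e > 0"
    then obtain n where n: "1 / 2 ^ n < e / 2" using ex_inverse_power2_less[of "e / 2"] by auto
    have "dist (centre (m (Suc j))) (centre (m (Suc k))) < e" if "n \<le> j" "j < k" for j k
      using close[of n "j - n"] close[of n "k - n"] that n by (simp add: dist_real_def)
    then show "\<exists>M. \<forall>j\<ge>M. \<forall>k>j. dist (centre (m (Suc j))) (centre (m (Suc k))) < e" by blast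
  qed
  then obtain x where x: "(\<lambda>n. centre (m (Suc n))) \<longlonglongrightarrow> x"
    using Cauchy_convergent_iff convergent_def by blast
  have "names_real (\<lambda>n. fst (prod_decode (m (Suc n)))) x"
    using close x unfolding names_real_def centre_def by blast
  \<comment> \<open>A limit of points of a ball is only known to lie in its closure; the closure of
    the next ball is inside the present open one, hence the shift by one.\<close>
  moreover have "x \<in> ball (centre (m (Suc n))) (radius (m (Suc n)))" for n
  proof -
    have "(\<lambda>i. centre (m (Suc (i + Suc n)))) \<longlonglongrightarrow> x" using x by (rule LIMSEQ_ignore_initial_segment)
    moreover have "centre (m (Suc (i + Suc n))) \<in> cball (centre (m (Suc (Suc n)))) (radius (m (Suc (Suc n))))" for i
      using inner[of "Suc n" i] by (simp add: add.commute less_imp_le)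
    ultimately have "x \<in> cball (centre (m (Suc (Suc n)))) (radius (m (Suc (Suc n))))"
      by (intro Lim_in_closed_set[OF closed_cball, of "\<lambda>i. centre (m (Suc (i + Suc n)))" _ _ sequentially]) auto
    then show ?thesis using m[of "Suc n"] unfolding tame_subball_def by (auto simp: dist_real_def)
  qed
  then have "x \<in> (\<Inter>n. RM_open_set (\<lambda>k. if tame f n k then k else 0))"
    unfolding RM_open_set_eq using m unfolding tame_subball_def by fastforce
  ultimately show ?thesis using that cont_points_eq_INT by blast
qed

section \<open>Computing with names\<close>

text \<open>The argument \<open>\<lambda>m. if m = 0 then n else b\<close> is \<open>n\<close>
  followed by the constant name of \<open>q_of b\<close>. If \<open>F\<close> names
  \<open>f\<close>, the two terms of the difference each err by at most 2^-n on rationals in [0,1],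
  whence the 2. The \<open>if\<close> form suits the rules for \<open>kcomp\<close>.\<close>

definition exceeds :: "((nat \<Rightarrow> nat) \<Rightarrow> nat) \<Rightarrow> nat \<Rightarrow> nat \<Rightarrow> real \<Rightarrow> bool" where
  "exceeds F b c t \<longleftrightarrow> (\<exists>n. t + 2 / 2 ^ n <
    q_of (F (\<lambda>m. if m = 0 then n else b)) - q_of (F (\<lambda>m. if m = 0 then n else c)))"

definition tame_code :: "((nat \<Rightarrow> nat) \<Rightarrow> nat) \<Rightarrow> nat \<Rightarrow> nat \<Rightarrow> bool" where
  "tame_code F n m \<longleftrightarrow> 0 \<le> centre m \<and> centre m \<le> 1 \<and> radius m < 1 / 2 ^ n \<and>
    \<not> (\<exists>b c. \<bar>q_of b - centre m\<bar> < radius m \<and> 0 \<le> q_of b \<and> q_of b \<le> 1 \<and>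
      \<bar>q_of c - centre m\<bar> < radius m \<and> 0 \<le> q_of c \<and> q_of c \<le> 1 \<and> exceeds F b c (1 / 2 ^ n))"

definition near :: "(nat \<Rightarrow> nat) \<Rightarrow> nat \<Rightarrow> nat \<Rightarrow> bool" where
  "near \<alpha> b k \<longleftrightarrow> (\<exists>n. \<bar>q_of b - q_of (\<alpha> n)\<bar> + 1 / 2 ^ n < 1 / 2 ^ k)"

text \<open>The right-hand side of \<open>less_osc_iff\<close>, with \<open>varies\<close>
  restricted to rational points and real values replaced by names.\<close>

definition below_osc :: "((nat \<Rightarrow> nat) \<Rightarrow> nat) \<Rightarrow> (nat \<Rightarrow> nat) \<Rightarrow> nat \<Rightarrow> bool" where
  "below_osc F \<alpha> s \<longleftrightarrow> (\<exists>a. q_of s < q_of a \<and> (\<forall>k. \<exists>b c.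
    near \<alpha> b k \<and> 0 \<le> q_of b \<and> q_of b \<le> 1 \<and> near \<alpha> c k \<and> 0 \<le> q_of c \<and> q_of c \<le> 1 \<and>
    exceeds F b c (q_of a)))"

definition below_sup :: "((nat \<Rightarrow> nat) \<Rightarrow> nat) \<Rightarrow> nat \<Rightarrow> nat \<Rightarrow> nat \<Rightarrow> bool" where
  "below_sup F p q s \<longleftrightarrow> (\<exists>b. q_of p \<le> q_of b \<and> q_of b \<le> q_of q \<and>
    (\<exists>n. q_of s + 1 / 2 ^ n < q_of (F (\<lambda>m. if m = 0 then n else b))))"

text \<open>A name of the extended real with left cut \<open>L\<close>: entry 0 is the tag of \<^const>\<open>names_ereal\<close>.\<close>

definition cut_name :: "(nat \<Rightarrow> bool) \<Rightarrow> nat \<Rightarrow> nat" where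
  "cut_name L n = (if n = 0 then if \<forall>s. L s then 1 else if \<exists>s. L s then 0 else 2
    else mu (\<lambda>s. L s \<and> (\<forall>s'. q_of s + 1 / 2 ^ Suc n < q_of s' \<longrightarrow> \<not> L s')))"

text \<open>In the finite case, entry \<open>Suc n\<close> is a rational below \<open>y\<close> such
  that none exceeding it by more than 2^-(n+2) is below \<open>y\<close>. As entry 0 is the tag,
  this is term \<open>n\<close> of the real's name, with the precision that
  \<open>names_realI\<close> wants.\<close>

lemma names_ereal_cut_name:
  assumes L: "\<And>s. L s \<longleftrightarrow> ereal (q_of s) < y"
  shows "names_ereal (cut_name L) y"
proof (cases y)
  case (real x)
  have Lx: "L s \<longleftrightarrow> q_of s < x" for s using L real by simp
  obtain s where "x - 1 < q_of s" "q_of s < x" using ex_q_of_between[of "x - 1" x] by auto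
  then have ex: "\<exists>s. L s" using Lx by blast
  obtain s where "x < q_of s" "q_of s < x + 1" using ex_q_of_between[of x "x + 1"] by auto
  then have nall: "\<not> (\<forall>s. L s)" using Lx by (meson less_asym)
  have "\<bar>q_of (cut_name L (Suc n)) - x\<bar> \<le> 1 / 2 ^ (n + 2)" for n
  proof -
    define P where "P s \<longleftrightarrow> L s \<and> (\<forall>s'. q_of s + 1 / 2 ^ (n + 2) < q_of s' \<longrightarrow> \<not> L s')" for s
    have "x - 1 / 2 ^ (n + 2) < x" by simp
    then obtain s where s: "x - 1 / 2 ^ (n + 2) < q_of s" "q_of s < x" by (rule ex_q_of_between)
    have "P s" unfolding P_def Lx using s by auto
    then have "P (mu P)" by (rule muI)
    moreover have "mu P = cut_name L (Suc n)" unfolding cut_name_def P_def by simp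
    ultimately have P: "P (cut_name L (Suc n))" by simp
    have "x \<le> q_of (cut_name L (Suc n)) + 1 / 2 ^ (n + 2)"
    proof (rule ccontr)
      assume "\<not> ?thesis"
      then have "q_of (cut_name L (Suc n)) + 1 / 2 ^ (n + 2) < x" by simp
      then obtain s' where "q_of (cut_name L (Suc n)) + 1 / 2 ^ (n + 2) < q_of s'" "q_of s' < x"
        by (rule ex_q_of_between)
      then show False using P unfolding P_def Lx by blast
    qed
    moreover have "q_of (cut_name L (Suc n)) < x" using P unfolding P_def Lx by blast
    ultimately show ?thesis by (simp add: abs_le_iff)
  qed
  then have "names_real (\<lambda>n. cut_name L (Suc n)) x" by (rule names_realI)
  moreover have "cut_name L 0 = 0" using ex nall by (simp add: cut_name_def)
  ultimately show ?thesis using real by (simp add: names_ereal_def)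
next
  case PInf
  then have "L s" for s using L by simp
  then have "cut_name L 0 = 1" by (simp add: cut_name_def)
  then show ?thesis unfolding names_ereal_def PInf infinity_ereal_def ereal.case .
next
  case MInf
  then have "\<not> L s" for s using L by simp
  then have "cut_name L 0 = 2" by (simp add: cut_name_def)
  then show ?thesis unfolding names_ereal_def MInf MInfty_eq_minfinity[symmetric] ereal.case .
qed

lemma kcomp_cut_name:
  assumes "dec (Suc a) b (\<lambda>\<rho> fs F. L (\<rho> 0) (\<lambda>i. \<rho> (Suc i)) fs F)" "kcomp a b \<phi>"
  shows "kcomp a b (\<lambda>\<rho> fs F. cut_name (\<lambda>s. L s \<rho> fs F) (\<phi> \<rho> fs F))"
proof -
  \<comment> \<open>Under \<open>mu\<close> and the inner quantifier, \<open>s'\<close> is variable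
    0 and \<open>s\<close> is variable 1, so \<open>L\<close> applied to \<open>s'\<close> has to
    skip one variable before the parameters.\<close>
  have 1: "dec (Suc (Suc a)) b (\<lambda>\<rho> fs F. L (\<rho> 0) (\<lambda>i. \<rho> (Suc (Suc i))) fs F)"
  proof -
    have "kcomp (Suc (Suc a)) b (\<lambda>\<rho> fs F. if i = 0 then \<rho> 0 else \<rho> (Suc i))" if "i < Suc a" for i
      using that by (cases "i = 0") (auto intro: kcomp_var)
    then show ?thesis
      using kcomp_subst[OF assms(1)[unfolded dec_def], of "Suc (Suc a)"
          "\<lambda>i \<rho> fs F. if i = 0 then \<rho> 0 else \<rho> (Suc i)"]
      unfolding dec_def by simp
  qed
  have 2: "kcomp (Suc a) b (\<lambda>\<rho> fs F. \<phi> (\<lambda>i. \<rho> (Suc i)) fs F)"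
    by (rule kcomp_subst[OF assms(2)]) (simp add: kcomp_var)
  have 3: "kcomp (Suc (Suc a)) b (\<lambda>\<rho> fs F. \<phi> (\<lambda>i. \<rho> (Suc (Suc i))) fs F)"
    by (rule kcomp_subst[OF assms(2)]) (simp add: kcomp_var)
  show ?thesis unfolding cut_name_def
    by (intro assms 1 2 3 qcomp_intros) simp_all
qed

section \<open>Correctness of the tests for a named quasi-continuous function\<close>

context
  fixes f F
  assumes qc: "quasi_continuous f" and F: "names_fun F f"
begin

lemma names_fun_q_of:
  assumes "q_of b \<in> {0..1}"
  shows "names_real (\<lambda>n. F (\<lambda>m. if m = 0 then n else b)) (f (q_of b))"
proof -
  have eq: "case_nat n (\<lambda>_. b) = (\<lambda>m. if m = 0 then n else b)" for n
    by (auto simp: fun_eq_iff split: nat.split)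
  have "names_real (\<lambda>n. F (case_nat n (\<lambda>_. b))) (f (q_of b))"
    using F assms names_real_const[of b] unfolding names_fun_def by blast
  then show ?thesis unfolding eq .
qed

lemma exceeds_iff:
  assumes "q_of b \<in> {0..1}" "q_of c \<in> {0..1}"
  shows "exceeds F b c t \<longleftrightarrow> t < f (q_of b) - f (q_of c)"
  unfolding exceeds_def
proof (rule less_limit_iff[symmetric])
  fix n
  show "\<bar>q_of (F (\<lambda>m. if m = 0 then n else b)) - q_of (F (\<lambda>m. if m = 0 then n else c)) -
      (f (q_of b) - f (q_of c))\<bar> \<le> 2 / 2 ^ n"
    using names_real_approx[OF names_fun_q_of[OF assms(1)], of n]
      names_real_approx[OF names_fun_q_of[OF assms(2)], of n] by linarith
qed

lemma tame_code_iff: "tame_code F n m \<longleftrightarrow> tame f n m"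
proof -
  have "\<bar>q_of b - centre m\<bar> < radius m \<and> 0 \<le> q_of b \<and> q_of b \<le> 1 \<and>
      \<bar>q_of c - centre m\<bar> < radius m \<and> 0 \<le> q_of c \<and> q_of c \<le> 1 \<and> exceeds F b c (1 / 2 ^ n) \<longleftrightarrow>
    q_of b \<in> ball (centre m) (radius m) \<inter> {0..1} \<and> q_of c \<in> ball (centre m) (radius m) \<inter> {0..1} \<and>
      1 / 2 ^ n < f (q_of b) - f (q_of c)" for b c
    using exceeds_iff[of b c "1 / 2 ^ n"] by (auto simp: dist_real_def abs_minus_commute)
  then show ?thesis
    unfolding tame_code_def tame_def varies_iff_q_of[OF qc open_ball] by simp
qed

lemma below_sup_iff:
  assumes "0 \<le> q_of p" "q_of q \<le> 1"
  shows "below_sup F p q s \<longleftrightarrow> ereal (q_of s) < (SUP x\<in>{q_of p..q_of q}. ereal (f x))"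
proof -
  have "(\<exists>n. q_of s + 1 / 2 ^ n < q_of (F (\<lambda>m. if m = 0 then n else b))) \<longleftrightarrow> q_of s < f (q_of b)"
    if "q_of p \<le> q_of b" "q_of b \<le> q_of q" for b
  proof (rule less_limit_iff[symmetric], rule names_real_approx, rule names_fun_q_of)
    show "q_of b \<in> {0..1}" using that assms unfolding atLeastAtMost_iff by linarith
  qed
  then show ?thesis unfolding less_SUP_iff_q_of[OF qc assms] below_sup_def by blast
qed

lemma near_iff:
  assumes "names_real \<alpha> x"
  shows "near \<alpha> b k \<longleftrightarrow> q_of b \<in> ball x (1 / 2 ^ k)"
proof -
  \<comment> \<open>\<open>less_limit_iff\<close> bounds a limit from below, so the distance, which
    needs an upper bound, enters negated.\<close>
  have "- (1 / 2 ^ k) < - \<bar>q_of b - x\<bar> \<longleftrightarrow> (\<exists>n. - (1 / 2 ^ k) + 1 / 2 ^ n < - \<bar>q_of b - q_of (\<alpha> n)\<bar>)"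
  proof (rule less_limit_iff)
    fix n
    show "\<bar>- \<bar>q_of b - q_of (\<alpha> n)\<bar> - - \<bar>q_of b - x\<bar>\<bar> \<le> 1 / 2 ^ n"
      using names_real_approx[OF assms, of n] by linarith
  qed
  moreover have "- (1 / 2 ^ k) + 1 / 2 ^ n < - \<bar>q_of b - q_of (\<alpha> n)\<bar> \<longleftrightarrow>
    \<bar>q_of b - q_of (\<alpha> n)\<bar> + 1 / 2 ^ n < 1 / 2 ^ k" for n by linarith
  ultimately show ?thesis unfolding near_def by (auto simp: dist_real_def abs_minus_commute)
qed

lemma below_osc_iff:
  assumes "x \<in> {0..1}" "names_real \<alpha> x"
  shows "below_osc F \<alpha> s \<longleftrightarrow> ereal (q_of s) < osc f x"
proof -
  have "near \<alpha> b k \<and> 0 \<le> q_of b \<and> q_of b \<le> 1 \<and> near \<alpha> c k \<and> 0 \<le> q_of c \<and> q_of c \<le> 1 \<and>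
      exceeds F b c (q_of a) \<longleftrightarrow>
    q_of b \<in> ball x (1 / 2 ^ k) \<inter> {0..1} \<and> q_of c \<in> ball x (1 / 2 ^ k) \<inter> {0..1} \<and>
      q_of a < f (q_of b) - f (q_of c)" for a b c k
    using exceeds_iff[of b c "q_of a"] near_iff[OF assms(2)] by auto
  then show ?thesis
    unfolding less_osc_iff[OF assms(1)] varies_iff_q_of[OF qc open_ball] below_osc_def by simp
qed

end

section \<open>Indices for the five claims\<close>

lemma dec_below_osc:
  assumes "kcomp a 1 \<phi>"
  shows "dec a 1 (\<lambda>\<rho> fs F. below_osc F (fs ! 0) (\<phi> \<rho> fs F))"
  unfolding dec_def
\<comment> \<open>Binding the value of \<open>\<phi>\<close> to a variable first avoids lifting
  \<open>\<phi>\<close> under the quantifiers of \<open>below_osc\<close>.\<close>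
proof (rule kcomp_subst1[OF _ assms], fold dec_def)
  show "dec (Suc a) 1 (\<lambda>\<rho> fs F. below_osc F (fs ! 0) (\<rho> 0))"
    unfolding below_osc_def near_def exceeds_def by (intro qcomp_intros) simp_all
qed

lemma dec_tame_code:
  assumes "i < a" "j < a"
  shows "dec a b (\<lambda>\<rho> fs F. tame_code F (\<rho> i) (\<rho> j))"
  unfolding tame_code_def exceeds_def centre_def radius_def
  by (intro qcomp_intros) (use assms in simp_all)

lemma decide_cont_points:
  "\<exists>e. \<forall>f F. quasi_continuous f \<and> names_fun F f \<longrightarrow>
    (\<forall>x\<in>{0..1}. \<forall>\<alpha>. names_real \<alpha> x \<longrightarrow>
      kleene e [] [\<alpha>] [F, exists2] (if x \<in> cont_points f then 1 else 0))"
proof -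
  \<comment> \<open>Code 0 stands for the rational 0, so this tests whether the oscillation is
    positive; the output 1 means continuity.\<close>
  have "kcomp 0 1 (\<lambda>\<rho> fs F. if below_osc F (fs ! 0) 0 then 0 else 1)"
    by (intro kcomp_intros dec_below_osc)
  then obtain e where e: "kleene e (map \<rho> [0..<0]) fs [F, exists2]
      (if below_osc F (fs ! 0) 0 then 0 else 1)" if "length fs = 1" for \<rho> fs F
    unfolding kcomp_iff by blast
  have "kleene e [] [\<alpha>] [F, exists2] (if x \<in> cont_points f then 1 else 0)"
    if "quasi_continuous f" "names_fun F f" "x \<in> {0..1}" "names_real \<alpha> x" for f F x \<alpha>
    using e[of "[\<alpha>]" id F] below_osc_iff[OF that, of 0] cont_points_iff_osc[OF that(3), of f]
    by (cases "0 < osc f x") (simp_all add: q_of_0 zero_ereal_def)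
  then show ?thesis by blast
qed

lemma compute_cont_point:
  "\<exists>e. \<forall>f F. quasi_continuous f \<and> names_fun F f \<longrightarrow>
    (\<exists>\<gamma>. kleene_fun e [] [] [F, exists2] \<gamma> \<and> (\<exists>x\<in>cont_points f. names_real \<gamma> x))"
proof -
  obtain r where r: "q_of r = 1" by (rule ex_q_of_eq[of 1]) simp
  \<comment> \<open>The initial ball only has to meet the hypotheses of
    \<open>ex_tame_subball\<close>.\<close>
  obtain m0 where m0: "centre m0 = 0" "radius m0 = 1"
    by (rule ex_ball_code[of 0 r]) (simp add: r q_of_0)
  \<comment> \<open>This is \<open>tame_subball\<close> expressed through \<open>F\<close>, because
    the index must not depend on \<open>f\<close>.\<close>
  define ref where "ref F n m m' \<longleftrightarrow> tame_code F n m' \<and> 0 < radius m' \<and>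
    \<bar>centre m' - centre m\<bar> + radius m' < radius m" for F n m m'
  define M where "M F n = rec_nat m0 (\<lambda>n m. mu (\<lambda>m'. ref F n m m')) n" for F n
  have "kcomp 1 0 (\<lambda>\<rho> fs F. fst (prod_decode (M F (Suc (\<rho> 0)))))"
    unfolding M_def ref_def centre_def radius_def
    by (intro qcomp_intros kcomp_rec dec_tame_code) simp_all
  then obtain e where e: "kleene e (map \<rho> [0..<1]) fs [F, exists2]
      (fst (prod_decode (M F (Suc (\<rho> 0)))))" if "length fs = 0" for \<rho> fs F
    unfolding kcomp_iff by blast
  have "\<exists>\<gamma>. kleene_fun e [] [] [F, exists2] \<gamma> \<and> (\<exists>x\<in>cont_points f. names_real \<gamma> x)"
    if "quasi_continuous f" "names_fun F f" for f F
  proof -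
    have ref: "ref F n m m' \<longleftrightarrow> tame_subball f n m m'" for n m m'
      unfolding ref_def tame_subball_def tame_code_iff[OF that] ..
    have M_Suc: "tame_subball f n (M F n) (M F (Suc n))"
      if n: "centre (M F n) \<in> {0..1}" "0 < radius (M F n)" for n
    proof -
      obtain m' where "tame_subball f n (M F n) m'"
        using ex_tame_subball[OF \<open>quasi_continuous f\<close> n] by blast
      then have "tame_subball f n (M F n) (mu (\<lambda>m'. tame_subball f n (M F n) m'))" by (rule muI)
      then show ?thesis by (simp add: M_def ref)
    qed
    have "centre (M F n) \<in> {0..1} \<and> 0 < radius (M F n)" for n
    proof (induction n)
      case 0
      then show ?case by (simp add: M_def m0)
    next
      case (Suc n)
      then show ?case using M_Suc[of n] unfolding tame_subball_def tame_def by blast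
    qed
    then have "tame_subball f n (M F n) (M F (Suc n))" for n using M_Suc by blast
    then obtain x where "x \<in> cont_points f" "names_real (\<lambda>n. fst (prod_decode (M F (Suc n)))) x"
      by (rule nested_balls_converge)
    moreover have "kleene_fun e [] [] [F, exists2] (\<lambda>n. fst (prod_decode (M F (Suc n))))"
      unfolding kleene_fun_def
    proof
      fix n show "kleene e [n] [] [F, exists2] (fst (prod_decode (M F (Suc n))))"
        using e[of "[]" "\<lambda>_. n" F] by simp
    qed
    ultimately show ?thesis by blast
  qed
  then show ?thesis by blast
qed

lemma compute_open_sets:
  "\<exists>e. \<forall>f F. quasi_continuous f \<and> names_fun F f \<longrightarrow>
    (\<exists>c. (\<forall>n. kleene_fun e [n] [] [F, exists2] (c n)) \<and> cont_points f = (\<Inter>n. RM_open_set (c n)))"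
proof -
  \<comment> \<open>Variable 0 is the position in the sequence of balls and variable 1 the number of
    the open set, because \<open>kleene_fun\<close> prepends the varying argument.\<close>
  have "kcomp 2 0 (\<lambda>\<rho> fs F. if tame_code F (\<rho> 1) (\<rho> 0) then \<rho> 0 else 0)"
    by (intro kcomp_intros dec_tame_code) simp_all
  then obtain e where e: "kleene e (map \<rho> [0..<2]) fs [F, exists2]
      (if tame_code F (\<rho> 1) (\<rho> 0) then \<rho> 0 else 0)" if "length fs = 0" for \<rho> fs F
    unfolding kcomp_iff by blast
  have "\<exists>c. (\<forall>n. kleene_fun e [n] [] [F, exists2] (c n)) \<and> cont_points f = (\<Inter>n. RM_open_set (c n))"
    if "quasi_continuous f" "names_fun F f" for f F
  proof (intro exI conjI allI)
    show "cont_points f = (\<Inter>n. RM_open_set (\<lambda>m. if tame f n m then m else 0))"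
      by (rule cont_points_eq_INT)
    show "kleene_fun e [n] [] [F, exists2] (\<lambda>m. if tame f n m then m else 0)" for n
      unfolding kleene_fun_def
    proof
      fix m show "kleene e [m, n] [] [F, exists2] (if tame f n m then m else 0)"
        using e[of "[]" "case_nat m (\<lambda>_. n)" F] tame_code_iff[OF that]
        by (cases "tame f n m") (simp_all add: numeral_2_eq_2)
    qed
  qed
  then show ?thesis by blast
qed

lemma compute_osc:
  "\<exists>e. \<forall>f F. quasi_continuous f \<and> names_fun F f \<longrightarrow>
    (\<forall>x\<in>{0..1}. \<forall>\<alpha>. names_real \<alpha> x \<longrightarrow>
      (\<exists>\<gamma>. kleene_fun e [] [\<alpha>] [F, exists2] \<gamma> \<and> names_ereal \<gamma> (osc f x)))"
proof -
  have "kcomp 1 1 (\<lambda>\<rho> fs F. cut_name (\<lambda>s. below_osc F (fs ! 0) s) (\<rho> 0))"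
    by (intro kcomp_cut_name dec_below_osc kcomp_intros) simp_all
  then obtain e where e: "kleene e (map \<rho> [0..<1]) fs [F, exists2]
      (cut_name (\<lambda>s. below_osc F (fs ! 0) s) (\<rho> 0))" if "length fs = 1" for \<rho> fs F
    unfolding kcomp_iff by blast
  have "\<exists>\<gamma>. kleene_fun e [] [\<alpha>] [F, exists2] \<gamma> \<and> names_ereal \<gamma> (osc f x)"
    if "quasi_continuous f" "names_fun F f" "x \<in> {0..1}" "names_real \<alpha> x" for f F x \<alpha>
  proof (intro exI conjI)
    show "names_ereal (cut_name (below_osc F \<alpha>)) (osc f x)"
      by (rule names_ereal_cut_name, rule below_osc_iff[OF that])
    show "kleene_fun e [] [\<alpha>] [F, exists2] (cut_name (below_osc F \<alpha>))"
      unfolding kleene_fun_def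
    proof
      fix n show "kleene e [n] [\<alpha>] [F, exists2] (cut_name (below_osc F \<alpha>) n)"
        using e[of "[\<alpha>]" "\<lambda>_. n" F] by simp
    qed
  qed
  then show ?thesis by blast
qed

lemma compute_sup:
  "\<exists>e. \<forall>f F. quasi_continuous f \<and> names_fun F f \<longrightarrow>
    (\<forall>p q. 0 \<le> q_of p \<and> q_of p \<le> q_of q \<and> q_of q \<le> 1 \<longrightarrow>
      (\<exists>\<gamma>. kleene_fun e [p, q] [] [F, exists2] \<gamma> \<and>
        names_ereal \<gamma> (SUP x\<in>{q_of p..q_of q}. ereal (f x))))"
proof -
  have "kcomp 3 0 (\<lambda>\<rho> fs F. cut_name (\<lambda>s. below_sup F (\<rho> 1) (\<rho> 2) s) (\<rho> 0))"
    unfolding below_sup_def by (intro kcomp_cut_name qcomp_intros) simp_all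
  then obtain e where e: "kleene e (map \<rho> [0..<3]) fs [F, exists2]
      (cut_name (\<lambda>s. below_sup F (\<rho> 1) (\<rho> 2) s) (\<rho> 0))" if "length fs = 0" for \<rho> fs F
    unfolding kcomp_iff by blast
  have "\<exists>\<gamma>. kleene_fun e [p, q] [] [F, exists2] \<gamma> \<and>
      names_ereal \<gamma> (SUP x\<in>{q_of p..q_of q}. ereal (f x))"
    if "quasi_continuous f" "names_fun F f" "0 \<le> q_of p" "q_of q \<le> 1" for f F p q
  proof (intro exI conjI)
    show "names_ereal (cut_name (below_sup F p q)) (SUP x\<in>{q_of p..q_of q}. ereal (f x))"
      by (rule names_ereal_cut_name, rule below_sup_iff[OF that])
    show "kleene_fun e [p, q] [] [F, exists2] (cut_name (below_sup F p q))"
      unfolding kleene_fun_def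
    proof
      fix n show "kleene e [n, p, q] [] [F, exists2] (cut_name (below_sup F p q) n)"
        using e[of "[]" "case_nat n (case_nat p (\<lambda>_. q))" F]
        by (simp add: numeral_2_eq_2 numeral_3_eq_3)
    qed
  qed
  then show ?thesis by blast
qed

theorem theorem1:
  shows
    "(\<exists>e. \<forall>f F. quasi_continuous f \<and> names_fun F f \<longrightarrow>
        (\<forall>x\<in>{0..1}. \<forall>\<alpha>. names_real \<alpha> x \<longrightarrow>
          kleene e [] [\<alpha>] [F, exists2] (if x \<in> cont_points f then 1 else 0))) \<and>
     (\<exists>e. \<forall>f F. quasi_continuous f \<and> names_fun F f \<longrightarrow>
        (\<exists>\<gamma>. kleene_fun e [] [] [F, exists2] \<gamma> \<and> (\<exists>x\<in>cont_points f. names_real \<gamma> x))) \<and>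
     (\<exists>e. \<forall>f F. quasi_continuous f \<and> names_fun F f \<longrightarrow>
        (\<exists>c. (\<forall>n. kleene_fun e [n] [] [F, exists2] (c n)) \<and>
          cont_points f = (\<Inter>n. RM_open_set (c n)))) \<and>
     (\<exists>e. \<forall>f F. quasi_continuous f \<and> names_fun F f \<longrightarrow>
        (\<forall>x\<in>{0..1}. \<forall>\<alpha>. names_real \<alpha> x \<longrightarrow>
          (\<exists>\<gamma>. kleene_fun e [] [\<alpha>] [F, exists2] \<gamma> \<and> names_ereal \<gamma> (osc f x)))) \<and>
     (\<exists>e. \<forall>f F. quasi_continuous f \<and> names_fun F f \<longrightarrow>
        (\<forall>p q. 0 \<le> q_of p \<and> q_of p \<le> q_of q \<and> q_of q \<le> 1 \<longrightarrow>
          (\<exists>\<gamma>. kleene_fun e [p, q] [] [F, exists2] \<gamma> \<and>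
            names_ereal \<gamma> (SUP x\<in>{q_of p..q_of q}. ereal (f x)))))"
  using decide_cont_points compute_cont_point compute_open_sets compute_osc compute_sup
  by (intro conjI)

end
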